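(* Suppose that the connected state graph $G_\sigma$, embedded as the spine of an oriented state surface $S_\sigma$, is planar and has no cut-vertices. Let $\phi\colon\pi_1(G_\sigma,x)\to\pi_1(S^3-G_\sigma,y)$ be the Stallings map. A generator $\gamma_i$ of $\pi_1(G_\sigma,x)$ is represented by a word in the edges of $G_\sigma$. Its image under $\phi$ is represented by a word in the letters $\{u_1^{\pm1},\dots,u_n^{\pm1}\}$, where each edge $e$ contributes a letter as follows, using the labeling of directed edges by the letters $u_j$ or $1$ described in the context: (1) if $u_j$ is the label on $e$ and $\gamma_i$ runs along $e$ from $+$ to $-$, write $u_j$; (2) if $u_j$ is the label on $e$ and $\gamma_i$ runs along $e$ from $-$ to $+$, write $u_j^{-1}$; (3) if $e$ is labeled $1$ and $\gamma_i$ runs along $e$, write no letters.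
   Context: Setting. $G_\sigma$ is a graph embedded in the projection plane $P$, with edges labeled $A$ or $B$. $S_\sigma\subset S^3$ is its associated state surface: a disk in $P$ at each vertex and a half-twisted band along each edge, where along an edge labeled $A$ the boundary strand passing over crosses from the right side to the left side of the edge as one travels along it (in either direction), and along an edge labeled $B$ from left to right. A cut-vertex of a graph $G$ is a vertex $v$ with $G=G_1\cup G_2$, $G_1\cap G_2=\{v\}$ and each $G_i$ containing at least one edge. As $S_\sigma$ is oriented, $G_\sigma$ is bipartite; its vertices are labeled alternately $+$ and $-$, where at a $+$ vertex the positive side of $S_\sigma$ faces above $P$ and at a $-$ vertex below. The basepoint $x$ is a vertex labeled $+$. Stallings map. Let $S_\sigma\times[-1,1]$ be a regular neighborhood, $S_\sigma^+=S_\sigma\times\{1\}$ the positive push-off, $f\colon S_\sigma\to S_\sigma^+\subset S^3-S_\sigma$ the push-off map, and $y=f(x)$. The Stallings map $\phi\colon\pi_1(G_\sigma,x)\to\pi_1(S^3-G_\sigma,y)$ is induced by the inclusion $G_\sigma\hookrightarrow S_\sigma$, followed by $f$, followed by the inclusion $S^3-S_\sigma\hookrightarrow S^3-G_\sigma$ (a homotopy equivalence). Generators. $S^3-S_\sigma$ is a handlebody with a 0-handle $H_+$ above $P$, a 0-handle $H_-$ below $P$, and for each region $R_j$ of $P-G_\sigma$ a 1-handle $T_j$ through $R_j$ joining $H_+$ to $H_-$. $R_0$ is the unbounded region and $R_1,\dots,R_n$ the bounded ones. For $1\le j\le n$, $u_j\in\pi_1(S^3-G_\sigma,y)$ is the class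 of the loop based at $y\in H_+$ that runs down $T_j$ to $H_-$ and back up $T_0$ to $y$; $u_1,\dots,u_n$ generate $\pi_1(S^3-G_\sigma,y)$. Labeling. Direct each edge from $+$ to $-$. If the edge is labeled $A$, assign it $u_i$, where $R_i$ is the region to the left of the directed edge, or $1$ if that region is unbounded. If it is labeled $B$, assign $u_j$, where $R_j$ is the region to the right, or $1$ if that region is unbounded. *)

theory Defs
  imports "HOL-Complex_Analysis.Complex_Analysis" "HOL-Algebra.Group"
begin

section \<open>Fundamental groups\<close>

definition loops_at :: "'a::topological_space set \<Rightarrow> 'a \<Rightarrow> (real \<Rightarrow> 'a) set" where
  "loops_at X x = {p. path p \<and> path_image p \<subseteq> X \<and> pathstart p = x \<and> pathfinish p = x}"

definition path_class :: "'a::topological_space set \<Rightarrow> (real \<Rightarrow> 'a) \<Rightarrow> (real \<Rightarrow> 'a) set" where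
  "path_class X p = {q. homotopic_paths X p q}"

definition pi1 :: "'a::topological_space set \<Rightarrow> 'a \<Rightarrow> (real \<Rightarrow> 'a) set monoid" where
  "pi1 X x = \<lparr>carrier = path_class X ` loops_at X x,
              mult = (\<lambda>C D. {r. \<exists>p\<in>C. \<exists>q\<in>D. homotopic_paths X (p +++ q) r}),
              one = path_class X (\<lambda>_. x)\<rparr>"

text \<open>The map on classes induced by \<open>f\<close>; homotopies are taken in the target space \<open>Y\<close>.\<close>

definition pi1_map ::
  "'b::topological_space set \<Rightarrow> ('a \<Rightarrow> 'b) \<Rightarrow> (real \<Rightarrow> 'a) set \<Rightarrow> (real \<Rightarrow> 'b) set" where
  "pi1_map Y f C = {q. \<exists>p\<in>C. homotopic_paths Y (f \<circ> p) q}"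

lemma path_class_eq_iff:
  assumes "p \<in> loops_at X x"
  shows "path_class X p = path_class X q \<longleftrightarrow> homotopic_paths X p q"
proof
  assume "path_class X p = path_class X q"
  moreover have "p \<in> path_class X p"
    using assms by (simp add: path_class_def loops_at_def)
  ultimately show "homotopic_paths X p q"
    by (simp add: path_class_def homotopic_paths_sym)
next
  assume pq: "homotopic_paths X p q"
  have "homotopic_paths X p r \<longleftrightarrow> homotopic_paths X q r" for r
    using pq homotopic_paths_sym[OF pq] homotopic_paths_trans by metis
  then show "path_class X p = path_class X q"
    by (simp add: path_class_def)
qed

lemma pi1_mult_path_class:
  assumes "p \<in> loops_at X x" "q \<in> loops_at X x"
  shows "path_class X p \<otimes>\<^bsub>pi1 X x\<^esub> path_class X q = path_class X (p +++ q)"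
proof -
  have "homotopic_paths X (p +++ q) r"
    if "homotopic_paths X p p'" "homotopic_paths X q q'" "homotopic_paths X (p' +++ q') r"
    for p' q' r
  proof -
    have "homotopic_paths X (p +++ q) (p' +++ q')"
      using that assms by (intro homotopic_paths_join) (auto simp: loops_at_def)
    then show ?thesis
      using that(3) by (rule homotopic_paths_trans)
  qed
  moreover have "homotopic_paths X p p" "homotopic_paths X q q"
    using assms by (auto simp: loops_at_def)
  ultimately have "(\<exists>p'. homotopic_paths X p p' \<and> (\<exists>q'. homotopic_paths X q q' \<and>
      homotopic_paths X (p' +++ q') r)) \<longleftrightarrow> homotopic_paths X (p +++ q) r" for r
    by metis
  then show ?thesis
    by (simp add: pi1_def path_class_def)
qed

lemma group_pi1:
  fixes x :: "'a::real_normed_vector"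
  assumes "x \<in> X"
  shows "group (pi1 X x)"
proof -
  have one: "\<one>\<^bsub>pi1 X x\<^esub> = path_class X (linepath x x)"
    by (simp add: pi1_def linepath_refl)
  have c: "linepath x x \<in> loops_at X x"
    using assms by (simp add: loops_at_def)
  have carr: "carrier (pi1 X x) = path_class X ` loops_at X x"
    by (simp add: pi1_def)
  have j: "p +++ q \<in> loops_at X x" if "p \<in> loops_at X x" "q \<in> loops_at X x" for p q
    using that by (simp add: loops_at_def path_image_join)
  have rev: "reversepath p \<in> loops_at X x" if "p \<in> loops_at X x" for p
    using that by (simp add: loops_at_def)
  note mult = pi1_mult_path_class
  show ?thesis
  proof (rule groupI; (unfold carr)?)
    fix C D assume "C \<in> path_class X ` loops_at X x" "D \<in> path_class X ` loops_at X x"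
    then obtain p q where "p \<in> loops_at X x" "C = path_class X p"
      "q \<in> loops_at X x" "D = path_class X q"
      by (elim imageE)
    then show "C \<otimes>\<^bsub>pi1 X x\<^esub> D \<in> path_class X ` loops_at X x"
      by (simp add: mult j)
  next
    show "\<one>\<^bsub>pi1 X x\<^esub> \<in> path_class X ` loops_at X x"
      unfolding one using c by (rule imageI)
  next
    fix C D E
    assume "C \<in> path_class X ` loops_at X x" "D \<in> path_class X ` loops_at X x"
      "E \<in> path_class X ` loops_at X x"
    then obtain p q r where pqr: "p \<in> loops_at X x" "C = path_class X p"
      "q \<in> loops_at X x" "D = path_class X q" "r \<in> loops_at X x" "E = path_class X r"
      by (elim imageE)
    have "homotopic_paths X ((p +++ q) +++ r) (p +++ (q +++ r))"
      using pqr by (intro homotopic_paths_sym[OF homotopic_paths_assoc]) (simp_all add: loops_at_def)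
    then have "path_class X ((p +++ q) +++ r) = path_class X (p +++ (q +++ r))"
      using path_class_eq_iff[OF j[OF j]] pqr by blast
    then show "C \<otimes>\<^bsub>pi1 X x\<^esub> D \<otimes>\<^bsub>pi1 X x\<^esub> E = C \<otimes>\<^bsub>pi1 X x\<^esub> (D \<otimes>\<^bsub>pi1 X x\<^esub> E)"
      by (simp add: pqr mult j)
  next
    fix C assume "C \<in> path_class X ` loops_at X x"
    then obtain p where p: "p \<in> loops_at X x" "C = path_class X p"
      by (elim imageE)
    have "homotopic_paths X (linepath x x +++ p) p"
      using p by (intro homotopic_paths_lid') (simp_all add: loops_at_def)
    then have "path_class X (linepath x x +++ p) = path_class X p"
      using path_class_eq_iff[OF j[OF c p(1)]] by blast
    then show "\<one>\<^bsub>pi1 X x\<^esub> \<otimes>\<^bsub>pi1 X x\<^esub> C = C"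
      unfolding one p(2) mult[OF c p(1)] .
  next
    fix C assume "C \<in> path_class X ` loops_at X x"
    then obtain p where p: "p \<in> loops_at X x" "C = path_class X p"
      by (elim imageE)
    have "homotopic_paths X (reversepath p +++ p) (linepath x x)"
      using homotopic_paths_linv[of p X] p by (simp add: loops_at_def)
    then have "path_class X (reversepath p +++ p) = path_class X (linepath x x)"
      using path_class_eq_iff[OF j[OF rev[OF p(1)] p(1)]] by blast
    then have "path_class X (reversepath p) \<otimes>\<^bsub>pi1 X x\<^esub> C = \<one>\<^bsub>pi1 X x\<^esub>"
      unfolding one p(2) mult[OF rev[OF p(1)] p(1)] .
    then show "\<exists>D\<in>path_class X ` loops_at X x. D \<otimes>\<^bsub>pi1 X x\<^esub> C = \<one>\<^bsub>pi1 X x\<^esub>"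
      using imageI[OF rev[OF p(1)]] by (rule bexI)
  qed
qed

section \<open>The three-sphere and the projection plane\<close>

text \<open>
  The projection plane is \<open>\<complex>\<close> with its standard orientation, sitting in three-space
  \<open>\<complex> \<times> \<real>\<close> at height \<open>0\<close> and seen from above.  Three-space is placed in the unit sphere of
  \<open>(\<complex> \<times> \<real>) \<times> \<real>\<close> by inverse stereographic projection; the point at infinity is
  \<open>((0, 0), 1)\<close>.  Points at positive (negative) height correspond exactly to the points of
  the open hemisphere \<open>above\<close> (\<open>below\<close>).
\<close>

type_synonym space3 = "complex \<times> real"
type_synonym space4 = "space3 \<times> real"

definition S3 :: "space4 set" where
  "S3 = sphere 0 1"

definition stereo :: "space3 \<Rightarrow> space4" where
  "stereo p = ((2 / ((norm p)\<^sup>2 + 1)) *\<^sub>R p, ((norm p)\<^sup>2 - 1) / ((norm p)\<^sup>2 + 1))"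

definition plane :: "complex \<Rightarrow> space4" where
  "plane z = stereo (z, 0)"

definition above :: "space4 set" where
  "above = {q \<in> S3. snd (fst q) > 0}"

definition below :: "space4 set" where
  "below = {q \<in> S3. snd (fst q) < 0}"


section \<open>State graphs and state surfaces\<close>

datatype resolution = ResA | ResB

text \<open>
  A plane state graph consists of vertices, edges, an arc for every edge and its label.  The
  direction of the arc is an arbitrary reference direction.  The second record adds the data
  from which the state surface is built: a disk at each vertex, and for each edge a thickening
  of the arc, defined on the rectangle \<open>strip_dom\<close>.
\<close>

record 'e state_graph =
  verts :: "complex set"
  edges :: "'e set"
  curve :: "'e \<Rightarrow> real \<Rightarrow> complex"
  res :: "'e \<Rightarrow> resolution"

record 'e state_surface = "'e state_graph" +
  disk :: "complex \<Rightarrow> complex set"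
  strip :: "'e \<Rightarrow> complex \<Rightarrow> complex"

text \<open>Loops at a vertex are excluded; a graph with a loop has no orientable state surface.\<close>

definition plane_graph :: "('e, 'm) state_graph_scheme \<Rightarrow> bool" where
  "plane_graph G \<longleftrightarrow>
     finite (verts G) \<and> finite (edges G) \<and>
     (\<forall>e\<in>edges G. arc (curve G e) \<and>
        pathstart (curve G e) \<in> verts G \<and> pathfinish (curve G e) \<in> verts G \<and>
        curve G e ` {0<..<1} \<inter> verts G = {}) \<and>
     (\<forall>e\<in>edges G. \<forall>e'\<in>edges G. e \<noteq> e' \<longrightarrow>
        path_image (curve G e) \<inter> path_image (curve G e') \<subseteq> verts G)"

definition graph_set :: "('e, 'm) state_graph_scheme \<Rightarrow> complex set" where
  "graph_set G = verts G \<union> (\<Union>e\<in>edges G. path_image (curve G e))"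

definition subgraph_sets :: "('e, 'm) state_graph_scheme \<Rightarrow> complex set \<Rightarrow> 'e set \<Rightarrow> bool" where
  "subgraph_sets G W F \<longleftrightarrow> W \<subseteq> verts G \<and> F \<subseteq> edges G \<and>
     (\<forall>e\<in>F. pathstart (curve G e) \<in> W \<and> pathfinish (curve G e) \<in> W)"

definition cut_vertex :: "('e, 'm) state_graph_scheme \<Rightarrow> complex \<Rightarrow> bool" where
  "cut_vertex G v \<longleftrightarrow> (\<exists>W1 F1 W2 F2.
     subgraph_sets G W1 F1 \<and> subgraph_sets G W2 F2 \<and>
     W1 \<union> W2 = verts G \<and> F1 \<union> F2 = edges G \<and>
     W1 \<inter> W2 = {v} \<and> F1 \<inter> F2 = {} \<and> F1 \<noteq> {} \<and> F2 \<noteq> {})"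

text \<open>
  The strip of an edge is an orientation-preserving embedding of \<open>[0, 1] \<times> [-1, 1]\<close> (first
  coordinate along the edge, second coordinate across it, positive to the left) whose core is
  the edge.  Its first third lies in the disk at the start of the edge, its last third in the
  disk at the end; the middle third carries the band.
\<close>

definition strip_dom :: "complex set" where
  "strip_dom = cbox (Complex 0 (-1)) (Complex 1 1)"

definition band_dom :: "complex set" where
  "band_dom = cbox (Complex (1/3) (-1)) (Complex (2/3) 1)"

definition state_ribbon :: "'e state_surface \<Rightarrow> bool" where
  "state_ribbon G \<longleftrightarrow> plane_graph G \<and>
     (\<forall>v\<in>verts G. disk G v homeomorphic cball (0::complex) 1 \<and> v \<in> interior (disk G v)) \<and>
     (\<forall>v\<in>verts G. \<forall>w\<in>verts G. v \<noteq> w \<longrightarrow> disk G v \<inter> disk G w = {}) \<and>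
     (\<forall>e\<in>edges G.
        continuous_on strip_dom (strip G e) \<and> inj_on (strip G e) strip_dom \<and>
        winding_number (strip G e \<circ> rectpath (Complex 0 (-1)) (Complex 1 1))
          (strip G e (Complex (1/2) 0)) = 1 \<and>
        (\<forall>t\<in>{0..1}. strip G e (Complex t 0) = curve G e t) \<and>
        (\<forall>z\<in>strip_dom. \<forall>v\<in>verts G. strip G e z \<in> disk G v \<longleftrightarrow>
           v = pathstart (curve G e) \<and> Re z \<le> 1/3 \<or> v = pathfinish (curve G e) \<and> Re z \<ge> 2/3)) \<and>
     (\<forall>e\<in>edges G. \<forall>e'\<in>edges G. e \<noteq> e' \<longrightarrow>
        strip G e ` band_dom \<inter> strip G e' ` band_dom = {})"

text \<open>
  The cross-section of a band makes a half turn about its core as \<open>t\<close> runs through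
  \<open>[1/3, 2/3]\<close>.  The boundary strands are \<open>s = 1\<close>, which starts on the left of the edge, and
  \<open>s = -1\<close>, which starts on the right.  For the label \<open>A\<close> the strand \<open>s = -1\<close> is the one at
  positive height, so the strand passing over crosses from right to left; for \<open>B\<close> it is
  \<open>s = 1\<close>, crossing from left to right.
\<close>

definition band_height :: "resolution \<Rightarrow> real" where
  "band_height r = (case r of ResA \<Rightarrow> -1 | ResB \<Rightarrow> 1)"

definition band :: "'e state_surface \<Rightarrow> 'e \<Rightarrow> space3 set" where
  "band G e = {(strip G e (Complex t (s * cos \<theta>)), band_height (res G e) * s * sin \<theta>) | t s \<theta>.
     1/3 \<le> t \<and> t \<le> 2/3 \<and> -1 \<le> s \<and> s \<le> 1 \<and> \<theta> = pi * (3 * t - 1)}"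

definition surface :: "'e state_surface \<Rightarrow> space4 set" where
  "surface G = stereo ` ((\<Union>v\<in>verts G. disk G v \<times> {0}) \<union> (\<Union>e\<in>edges G. band G e))"

definition spine :: "('e, 'm) state_graph_scheme \<Rightarrow> space4 set" where
  "spine G = plane ` graph_set G"


section \<open>The oriented surface and the Stallings map\<close>

text \<open>
  A regular neighbourhood \<open>surface G \<times> [-1, 1]\<close>, given by its embedding \<open>N\<close>.  The orientation
  of the surface is recorded by which side \<open>N\<close> makes positive; a state surface has such an
  \<open>N\<close> iff it is orientable.  The last clause is thinness: the fibre over a vertex meets
  the plane in that vertex only, so that the positive side faces above or below there, and
  the push-off of a vertex lies in the corresponding 0-handle.  That the signs of the two
  ends of an edge differ is a consequence and not required here.
\<close>

definition regular_nbhd :: "'e state_surface \<Rightarrow> (space4 \<times> real \<Rightarrow> space4) \<Rightarrow> bool" where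
  "regular_nbhd G N \<longleftrightarrow>
     continuous_on (surface G \<times> {-1..1}) N \<and> inj_on N (surface G \<times> {-1..1}) \<and>
     N ` (surface G \<times> {-1..1}) \<subseteq> S3 \<and>
     (\<forall>q\<in>surface G. N (q, 0) = q) \<and>
     (\<forall>v\<in>verts G. \<forall>s\<in>{-1..1} - {0}. N (plane v, s) \<in> above \<union> below)"

definition push_off :: "(space4 \<times> real \<Rightarrow> space4) \<Rightarrow> space4 \<Rightarrow> space4" where
  "push_off N q = N (q, 1)"

definition positive_vertex :: "(space4 \<times> real \<Rightarrow> space4) \<Rightarrow> complex \<Rightarrow> bool" where
  "positive_vertex N v \<longleftrightarrow> push_off N (plane v) \<in> above"

definition stallings_map ::
  "'e state_surface \<Rightarrow> (space4 \<times> real \<Rightarrow> space4) \<Rightarrow> (real \<Rightarrow> space4) set \<Rightarrow> (real \<Rightarrow> space4) set" where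
  "stallings_map G N =
     pi1_map (S3 - spine G) (\<lambda>q. q) \<circ> pi1_map (S3 - surface G) (push_off N) \<circ>
     pi1_map (surface G) (\<lambda>q. q)"


section \<open>The loops around the regions\<close>

definition handle_core :: "complex \<Rightarrow> real \<Rightarrow> space4" where
  "handle_core a = stereo \<circ> linepath (a, 1) (a, -1)"

text \<open>
  A loop based at \<open>y\<close> above the plane that runs inside \<open>above\<close> to the top of a vertical segment
  through a point \<open>a\<close> of the region \<open>R\<close>, down this segment, inside \<open>below\<close> to a vertical segment
  through a point \<open>b\<close> of the unbounded region, up this segment, and back to \<open>y\<close> inside \<open>above\<close>.
  All these loops represent one element of the fundamental group of \<open>S3 - spine G\<close>, and
  \<open>region_class\<close> is that element as a set of loops.
\<close>

definition region_loop :: "('e, 'm) state_graph_scheme \<Rightarrow> space4 \<Rightarrow> complex set \<Rightarrow> (real \<Rightarrow> space4) \<Rightarrow> bool" where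
  "region_loop G y R g \<longleftrightarrow> (\<exists>a\<in>R. \<exists>b\<in>outside (graph_set G). \<exists>h1 h2 h3.
     path h1 \<and> path_image h1 \<subseteq> above \<and> pathstart h1 = y \<and> pathfinish h1 = stereo (a, 1) \<and>
     path h2 \<and> path_image h2 \<subseteq> below \<and> pathstart h2 = stereo (a, -1) \<and> pathfinish h2 = stereo (b, -1) \<and>
     path h3 \<and> path_image h3 \<subseteq> above \<and> pathstart h3 = stereo (b, 1) \<and> pathfinish h3 = y \<and>
     g = h1 +++ handle_core a +++ h2 +++ reversepath (handle_core b) +++ h3)"

definition region_class :: "('e, 'm) state_graph_scheme \<Rightarrow> space4 \<Rightarrow> complex set \<Rightarrow> (real \<Rightarrow> space4) set" where
  "region_class G y R = {q. \<exists>g. region_loop G y R g \<and> homotopic_paths (S3 - spine G) g q}"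


section \<open>Edge words and their images\<close>

text \<open>An oriented edge is a pair \<open>(e, d)\<close>; \<open>d = True\<close> means the direction of \<open>curve G e\<close>.\<close>

definition dcurve :: "('e, 'm) state_graph_scheme \<Rightarrow> 'e \<times> bool \<Rightarrow> real \<Rightarrow> complex" where
  "dcurve G = (\<lambda>(e, d). if d then curve G e else reversepath (curve G e))"

fun edge_walk :: "('e, 'm) state_graph_scheme \<Rightarrow> complex \<Rightarrow> ('e \<times> bool) list \<Rightarrow> complex \<Rightarrow> bool" where
  "edge_walk G u [] v \<longleftrightarrow> u \<in> verts G \<and> u = v"
| "edge_walk G u (s # w) v \<longleftrightarrow>
     fst s \<in> edges G \<and> pathstart (dcurve G s) = u \<and> edge_walk G (pathfinish (dcurve G s)) w v"

definition walk_path :: "('e, 'm) state_graph_scheme \<Rightarrow> complex \<Rightarrow> ('e \<times> bool) list \<Rightarrow> real \<Rightarrow> space4" where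
  "walk_path G x w = foldr (\<lambda>s p. (plane \<circ> dcurve G s) +++ p) w (\<lambda>_. plane x)"

text \<open>
  The region to the left of an oriented edge is the component of the complement of the graph
  that contains the points of the open middle part of the strip to the left of the edge.
\<close>

definition left_region :: "'e state_surface \<Rightarrow> 'e \<times> bool \<Rightarrow> complex set" where
  "left_region G = (\<lambda>(e, d). connected_component_set (- graph_set G)
     (strip G e (Complex (1/2) (if d then 1/2 else - 1/2))))"

definition right_region :: "'e state_surface \<Rightarrow> 'e \<times> bool \<Rightarrow> complex set" where
  "right_region G = (\<lambda>(e, d). left_region G (e, \<not> d))"

text \<open>
  The edge is directed from \<open>+\<close> to \<open>-\<close>.  The label \<open>1\<close> is \<open>None\<close>, and \<open>Some R\<close> is the label
  \<open>u_j\<close> for the bounded region \<open>R = R_j\<close>.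
\<close>

definition edge_label :: "'e state_surface \<Rightarrow> (space4 \<times> real \<Rightarrow> space4) \<Rightarrow> 'e \<Rightarrow> complex set option" where
  "edge_label G N e =
     (let d = positive_vertex N (pathstart (curve G e));
          R = (case res G e of ResA \<Rightarrow> left_region G (e, d) | ResB \<Rightarrow> right_region G (e, d))
      in if bounded R then Some R else None)"

definition step_letters ::
  "'e state_surface \<Rightarrow> (space4 \<times> real \<Rightarrow> space4) \<Rightarrow> 'e \<times> bool \<Rightarrow> (complex set \<times> bool) list" where
  "step_letters G N s = (case edge_label G N (fst s) of
       None \<Rightarrow> []
     | Some R \<Rightarrow> [(R, positive_vertex N (pathstart (dcurve G s)))])"

text \<open>A letter \<open>(R, True)\<close> stands for the generator of the region \<open>R\<close>, \<open>(R, False)\<close> for its inverse.\<close>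

definition word_value :: "('e, 'm) state_graph_scheme \<Rightarrow> space4 \<Rightarrow> (complex set \<times> bool) list \<Rightarrow> (real \<Rightarrow> space4) set" where
  "word_value G y ls =
     (let H = pi1 (S3 - spine G) y
      in foldr (\<lambda>(R, b) c. (if b then region_class G y R else inv\<^bsub>H\<^esub> region_class G y R) \<otimes>\<^bsub>H\<^esub> c)
           ls \<one>\<^bsub>H\<^esub>)"

end

theory Submission
  imports Defs
begin

text \<open>
  Both claims compare homotopy classes of paths, and both are proved by cutting a path into
  pieces that lie in simply connected sets, inside which a path is determined up to homotopy by
  its endpoints.

  That every class is represented by an edge walk: the open star of a vertex is contractible,
  the open stars cover the graph, and a point common to the stars of two different vertices lies
  inside an edge joining them.  A path inside one star slides along the radii of that star;
  passing from one star to the next costs one edge of the walk.  Such a local statement spreads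
  to all paths because it survives concatenation and homotopy (\<open>path_local_to_global\<close>).

  The value of the Stallings map: for a region \<open>R\<close>, let \<open>crossing_space R\<close> be the part of the
  three-sphere above or below the plane, together with \<open>R\<close> itself.  It is the union of two
  contractible open sets whose intersection is connected, so it is simply connected: up to
  homotopy there is exactly one way \<open>A\<^sub>R\<close> from \<open>y\<close> to a fixed point \<open>c\<close> below the plane
  that passes through \<open>R\<close> only.  The class \<open>u\<^sub>R\<close> is therefore that of \<open>A\<^sub>R\<close> followed by the
  reverse of \<open>A\<^sub>0\<close>, where \<open>A\<^sub>0\<close> passes through the unbounded region (\<open>region_class_eq\<close>); it is
  trivial when \<open>R\<close> is unbounded.

  The geometric heart is \<open>push_off_edge\<close>: the push-off of an edge is homotopic to a path in
  \<open>crossing_space R\<close>, where \<open>R\<close> is the region that labels the edge.  The regular neighbourhood is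
  merely a topological embedding, but sliding along its fibres replaces the push-off by one as
  close to the edge as desired, and meanwhile the ends stay above or below the plane.  Close to the
  edge the complement of the surface consists of two disjoint open sides, and a connected
  push-off stays in one of them.  The side which faces above at the tail turns with the band: half
  way along the edge it faces left for the label A and right for the label B, and at the head it
  faces below.  So it meets the plane only in the half of the band that lies in \<open>R\<close>.  In particular
  the signs of the two ends differ.

  Hence the push-off of a walk runs alternately down through regions \<open>R\<close> and up through regions
  \<open>S\<close>.  A descent followed by an ascent is \<open>A\<^sub>R\<close> followed by the reverse of \<open>A\<^sub>S\<close>, which equals
  \<open>u\<^sub>R\<close> times the inverse of \<open>u\<^sub>S\<close> since the two copies of \<open>A\<^sub>0\<close> cancel.  The induction in
  \<open>walk_push_off\<close> carries this out step by step, joining each vertex to \<open>y\<close> through the unbounded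
  region.
\<close>

section \<open>Calculus of paths up to homotopy\<close>

definition path_between :: "'a::topological_space set \<Rightarrow> 'a \<Rightarrow> 'a \<Rightarrow> (real \<Rightarrow> 'a) \<Rightarrow> bool" where
  "path_between X a b p \<longleftrightarrow> path p \<and> path_image p \<subseteq> X \<and> pathstart p = a \<and> pathfinish p = b"

lemma path_betweenD:
  assumes "path_between X a b p"
  shows "path p" "path_image p \<subseteq> X" "pathstart p = a" "pathfinish p = b" "a \<in> X" "b \<in> X"
  using assms by (auto simp: path_between_def)

lemma path_between_join [intro]:
  "path_between X a b p \<Longrightarrow> path_between X b c q \<Longrightarrow> path_between X a c (p +++ q)"
  by (auto simp: path_between_def path_image_join)

lemma path_between_reverse [intro]: "path_between X a b p \<Longrightarrow> path_between X b a (reversepath p)"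
  by (auto simp: path_between_def)

lemma path_between_mono: "path_between X a b p \<Longrightarrow> X \<subseteq> Y \<Longrightarrow> path_between Y a b p"
  by (auto simp: path_between_def)

lemma path_between_refl: "a \<in> X \<Longrightarrow> path_between X a a (linepath a a)"
  by (auto simp: path_between_def)

lemma path_between_image:
  "path_between X a b p \<Longrightarrow> continuous_on X f \<Longrightarrow> f ` X \<subseteq> Y \<Longrightarrow> path_between Y (f a) (f b) (f \<circ> p)"
  by (auto simp: path_between_def path_continuous_image pathstart_compose pathfinish_compose
      path_image_compose continuous_on_subset intro!: path_continuous_image)

lemma homotopic_refl: "path_between X a b p \<Longrightarrow> homotopic_paths X p p"
  by (simp add: path_between_def)

lemma homotopic_join:
  "homotopic_paths X p p' \<Longrightarrow> homotopic_paths X q q' \<Longrightarrow> path_between X a b p \<Longrightarrow>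
   path_between X b c q \<Longrightarrow> homotopic_paths X (p +++ q) (p' +++ q')"
  by (intro homotopic_paths_join) (auto simp: path_between_def)

lemma homotopic_join_left:
  "homotopic_paths X p p' \<Longrightarrow> path_between X a b p \<Longrightarrow> path_between X b c q \<Longrightarrow>
   homotopic_paths X (p +++ q) (p' +++ q)"
  by (blast intro: homotopic_join homotopic_refl)

lemma homotopic_join_right:
  "homotopic_paths X q q' \<Longrightarrow> path_between X a b p \<Longrightarrow> path_between X b c q \<Longrightarrow>
   homotopic_paths X (p +++ q) (p +++ q')"
  by (blast intro: homotopic_join homotopic_refl)

lemma homotopic_assoc:
  "path_between X a b p \<Longrightarrow> path_between X b c q \<Longrightarrow> path_between X c d r \<Longrightarrow>
   homotopic_paths X ((p +++ q) +++ r) (p +++ (q +++ r))"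
  by (rule homotopic_paths_sym[OF homotopic_paths_assoc]) (auto simp: path_between_def)

lemma homotopic_cancel:
  fixes X :: "'a::real_normed_vector set"
  assumes p: "path_between X a b p" and q: "path_between X a c q"
  shows "homotopic_paths X (p +++ (reversepath p +++ q)) q"
proof -
  note [trans] = homotopic_paths_trans
  have "homotopic_paths X (p +++ (reversepath p +++ q)) ((p +++ reversepath p) +++ q)"
    by (rule homotopic_paths_sym[OF homotopic_assoc]) (use p q in blast)+
  also have "homotopic_paths X \<dots> (linepath a a +++ q)"
    using p q homotopic_paths_rinv[of p X]
    by (intro homotopic_join_left[where a=a and b=a and c=c]) (auto simp: path_between_def path_image_join)
  also have "homotopic_paths X \<dots> q"
    using q by (intro homotopic_paths_lid') (auto simp: path_between_def)
  finally show ?thesis .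
qed

lemma homotopic_cancel':
  fixes X :: "'a::real_normed_vector set"
  assumes p: "path_between X a b p" and q: "path_between X b c q"
  shows "homotopic_paths X (reversepath p +++ (p +++ q)) q"
  using homotopic_cancel[OF path_between_reverse[OF p] q] by simp

lemma simply_connected_homotopic:
  fixes W :: "'a::real_normed_vector set"
  assumes "simply_connected W" "W \<subseteq> X" "path_between W a b p" "path_between W a b q"
  shows "homotopic_paths X p q"
proof -
  have "homotopic_paths W p q"
    using assms unfolding simply_connected_eq_homotopic_paths path_between_def by auto
  then show ?thesis using assms(2) by (rule homotopic_paths_subset)
qed

lemma path_connected_between:
  fixes W :: "'a::real_normed_vector set"
  assumes "path_connected W" "a \<in> W" "b \<in> W"
  obtains p where "path_between W a b p"
  using assms unfolding path_connected_def path_between_def by blast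

text \<open>
  In a convex parameter domain any two paths with common ends are homotopic, and the map carries the homotopy over.
\<close>

lemma homotopic_paths_convex_image:
  fixes F :: "'b::real_normed_vector \<Rightarrow> 'a::topological_space"
  assumes "convex K" "continuous_on K F" "F ` K \<subseteq> X" "path_between K a b p" "path_between K a b q"
  shows "homotopic_paths X (F \<circ> p) (F \<circ> q)"
proof -
  have "homotopic_paths K p q"
    using simply_connected_homotopic[OF convex_imp_simply_connected] assms by blast
  then show ?thesis
    using assms by (intro homotopic_paths_continuous_image) auto
qed

text \<open>
  To prove a homotopy invariant, multiplicative property of all paths in a space, it is enough to
  treat paths inside the members of an open cover: bisect the parameter interval until every piece
  is small, then join the pieces.
\<close>

lemma path_local_to_global:
  fixes X :: "'a::real_normed_vector set"
  assumes p: "path p" "path_image p \<subseteq> X"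
    and ope: "\<And>U. U \<in> \<U> \<Longrightarrow> openin (top_of_set X) U" and cover: "X \<subseteq> \<Union>\<U>"
    and small: "\<And>q U. U \<in> \<U> \<Longrightarrow> path q \<Longrightarrow> path_image q \<subseteq> U \<Longrightarrow> \<Phi> q"
    and join: "\<And>q r a b c. path_between X a b q \<Longrightarrow> path_between X b c r \<Longrightarrow> \<Phi> q \<Longrightarrow> \<Phi> r \<Longrightarrow> \<Phi> (q +++ r)"
    and hom: "\<And>q r. homotopic_paths X q r \<Longrightarrow> \<Phi> q \<Longrightarrow> \<Phi> r"
  shows "\<Phi> p"
proof -
  have "0 \<le> (0::real) \<and> (1::real) \<le> 1 \<longrightarrow> \<Phi> (subpath 0 1 p)"
  proof (rule Bolzano[where P = "\<lambda>a b. 0 \<le> a \<and> b \<le> 1 \<longrightarrow> \<Phi> (subpath a b p)"])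
    show "(0::real) \<le> 1" by simp
  next
    fix a b c :: real
    assume ab: "0 \<le> a \<and> b \<le> 1 \<longrightarrow> \<Phi> (subpath a b p)" and bc: "0 \<le> b \<and> c \<le> 1 \<longrightarrow> \<Phi> (subpath b c p)"
      and le: "a \<le> b" "b \<le> c"
    show "0 \<le> a \<and> c \<le> 1 \<longrightarrow> \<Phi> (subpath a c p)"
    proof
      assume ac: "0 \<le> a \<and> c \<le> 1"
      have sub: "path_between X (p u) (p v) (subpath u v p)" if "u \<in> {0..1}" "v \<in> {0..1}" for u v
        using p that path_image_subpath_subset[OF that, of p] by (auto simp: path_between_def)
      have "\<Phi> (subpath a b p +++ subpath b c p)"
        using ab bc ac le by (intro join[OF sub sub]) auto
      moreover have "homotopic_paths X (subpath a b p +++ subpath b c p) (subpath a c p)"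
        using p ac le by (intro homotopic_join_subpaths) auto
      ultimately show "\<Phi> (subpath a c p)" using hom by blast
    qed
  next
    fix x :: real assume x: "0 \<le> x" "x \<le> 1"
    then have "p x \<in> X" using p by (auto simp: path_image_def)
    then obtain U where U: "U \<in> \<U>" "p x \<in> U" using cover by blast
    have "openin (top_of_set {0..1}) ({0..1} \<inter> p -` U)"
      using p by (intro continuous_openin_preimage[OF _ _ ope[OF U(1)]]) (auto simp: path_def path_image_def)
    moreover have "x \<in> {0..1} \<inter> p -` U" using U x by auto
    ultimately obtain d where d: "d > 0" "\<And>y. y \<in> {0..1} \<Longrightarrow> dist y x < d \<Longrightarrow> p y \<in> U"
      unfolding openin_euclidean_subtopology_iff by blast
    show "\<exists>d>0. \<forall>a b. a \<le> x \<and> x \<le> b \<and> b - a < d \<longrightarrow> 0 \<le> a \<and> b \<le> 1 \<longrightarrow> \<Phi> (subpath a b p)"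
    proof (intro exI conjI allI impI)
      fix a b assume h: "a \<le> x \<and> x \<le> b \<and> b - a < d" "0 \<le> a \<and> b \<le> 1"
      have ab: "a \<in> {0..1}" "b \<in> {0..1}" "a \<le> b" using h x by auto
      have "p y \<in> U" if "y \<in> {a..b}" for y
        using that h by (intro d(2)) (auto simp: dist_real_def)
      then show "\<Phi> (subpath a b p)"
        using p ab by (intro small[OF U(1)]) (auto simp: path_image_subpath)
    qed (use d in auto)
  qed
  then show ?thesis by simp
qed

text \<open>
  The simplest case of the theorem of Seifert and van Kampen.  Each point is joined to a base point
  by a path \<open>d x\<close> that stays in every one of the two sets that contains \<open>x\<close>; for this the
  intersection has to be path connected.  A path is then homotopic to the detour through the base
  point, first if it lies in one of the two sets, and hence always.
\<close>

lemma simply_connected_Un: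
  fixes U V :: "'a::real_normed_vector set"
  assumes ope: "openin (top_of_set (U \<union> V)) U" "openin (top_of_set (U \<union> V)) V"
    and sc: "simply_connected U" "simply_connected V"
    and conn: "path_connected (U \<inter> V)" "U \<inter> V \<noteq> {}"
  shows "simply_connected (U \<union> V)"
proof -
  note [trans] = homotopic_paths_trans
  let ?X = "U \<union> V"
  obtain b where b: "b \<in> U" "b \<in> V" using conn by blast
  have pU: "path_connected U" "path_connected V"
    using sc simply_connected_imp_path_connected by blast+
  have "\<exists>d. (x \<in> U \<longrightarrow> path_between U b x d) \<and> (x \<in> V \<longrightarrow> path_between V b x d)" if x: "x \<in> ?X" for x
  proof -
    consider "x \<in> U \<inter> V" | "x \<in> U" "x \<notin> V" | "x \<in> V" "x \<notin> U" using x by blast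
    then show ?thesis
    proof cases
      case 1
      with b obtain d where "path_between (U \<inter> V) b x d"
        using path_connected_between[OF conn(1), of b x] by blast
      then show ?thesis using path_between_mono by blast
    qed (use b pU path_connected_between in metis)+
  qed
  then obtain d where dU: "\<And>x. x \<in> U \<Longrightarrow> path_between U b x (d x)"
    and dV: "\<And>x. x \<in> V \<Longrightarrow> path_between V b x (d x)" by (metis UnCI)
  then have d: "path_between ?X b x (d x)" if "x \<in> ?X" for x
    using that path_between_mono[of _ b x "d x" ?X] by blast
  have key: "homotopic_paths ?X p (reversepath (d (pathstart p)) +++ d (pathfinish p))"
    if "path p" "path_image p \<subseteq> ?X" for p
  proof (rule path_local_to_global[OF that, where \<U> = "{U, V}"])
    fix q W assume W: "W \<in> {U, V}" and q: "path q" "path_image q \<subseteq> W"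
    have dW: "\<And>x. x \<in> W \<Longrightarrow> path_between W b x (d x)" and sW: "simply_connected W" "W \<subseteq> ?X"
      using W dU dV sc by auto
    have "path_between W (pathstart q) (pathfinish q) q" using q by (auto simp: path_between_def)
    moreover from this have "path_between W (pathstart q) (pathfinish q)
        (reversepath (d (pathstart q)) +++ d (pathfinish q))"
      by (meson dW path_betweenD path_between_join path_between_reverse)
    ultimately show "homotopic_paths ?X q (reversepath (d (pathstart q)) +++ d (pathfinish q))"
      by (rule simply_connected_homotopic[OF sW])
  next
    fix q r x y z
    assume q: "path_between ?X x y q" and r: "path_between ?X y z r"
      and hq: "homotopic_paths ?X q (reversepath (d (pathstart q)) +++ d (pathfinish q))"
      and hr: "homotopic_paths ?X r (reversepath (d (pathstart r)) +++ d (pathfinish r))"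
    have ends: "pathstart q = x" "pathfinish q = y" "pathstart r = y" "pathfinish r = z"
      using q r by (auto simp: path_between_def)
    have D: "path_between ?X b x (d x)" "path_between ?X b y (d y)" "path_between ?X b z (d z)"
      using d path_betweenD q r by metis+
    have "homotopic_paths ?X (q +++ r) ((reversepath (d x) +++ d y) +++ (reversepath (d y) +++ d z))"
      using hq hr q r ends homotopic_join by metis
    also have "homotopic_paths ?X \<dots> (reversepath (d x) +++ (d y +++ (reversepath (d y) +++ d z)))"
      using D by (blast intro: homotopic_assoc)
    also have "homotopic_paths ?X \<dots> (reversepath (d x) +++ d z)"
      using D by (blast intro: homotopic_join_right homotopic_cancel)
    finally show "homotopic_paths ?X (q +++ r) (reversepath (d (pathstart (q +++ r))) +++ d (pathfinish (q +++ r)))"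
      by (simp add: ends)
  next
    fix q r assume h: "homotopic_paths ?X q r"
      and hq: "homotopic_paths ?X q (reversepath (d (pathstart q)) +++ d (pathfinish q))"
    then show "homotopic_paths ?X r (reversepath (d (pathstart r)) +++ d (pathfinish r))"
      by (metis homotopic_paths_imp_pathfinish homotopic_paths_imp_pathstart homotopic_paths_sym
          homotopic_paths_trans)
  qed (use ope in auto)
  show ?thesis
    unfolding simply_connected_eq_homotopic_paths
  proof (intro conjI allI impI)
    show "path_connected ?X" using pU conn by (intro path_connected_Un)
    fix p q assume h: "path p \<and> path_image p \<subseteq> ?X \<and> path q \<and> path_image q \<subseteq> ?X \<and>
      pathstart q = pathstart p \<and> pathfinish q = pathfinish p"
    then show "homotopic_paths ?X p q"
      using key[of p] key[of q] homotopic_paths_sym homotopic_paths_trans by metis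
  qed
qed

section \<open>Edge walks generate the fundamental group of a plane graph\<close>

locale drawn_graph =
  fixes G :: "('e, 'm) state_graph_scheme"
  assumes pg: "plane_graph G"
begin

abbreviation "\<Gamma> \<equiv> graph_set G"

definition spokes :: "complex \<Rightarrow> ('e \<times> bool) set" where
  "spokes v = {s. fst s \<in> edges G \<and> pathstart (dcurve G s) = v}"

text \<open>
  The arm of an oriented edge omits the far end, so that arms with a common start are disjoint
  away from it, even for parallel edges.
\<close>

definition arm :: "'e \<times> bool \<Rightarrow> complex set" where
  "arm s = dcurve G s ` {0..<1}"

definition star :: "complex \<Rightarrow> complex set" where
  "star v = insert v (\<Union>s\<in>spokes v. arm s)"

lemma finite_spokes: "finite (spokes v)"
proof (rule finite_subset)
  show "spokes v \<subseteq> edges G \<times> UNIV" by (auto simp: spokes_def mem_Times_iff)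
  show "finite (edges G \<times> (UNIV :: bool set))" using pg by (simp add: plane_graph_def)
qed

lemma dcurve_arc:
  assumes "fst s \<in> edges G"
  shows "arc (dcurve G s)" "pathstart (dcurve G s) \<in> verts G" "pathfinish (dcurve G s) \<in> verts G"
    "path_image (dcurve G s) = path_image (curve G (fst s))"
  using pg assms by (auto simp: plane_graph_def dcurve_def arc_reversepath split: prod.split)

lemma dcurve_interior:
  assumes "fst s \<in> edges G" "0 < t" "t < 1"
  shows "dcurve G s t \<notin> verts G"
proof -
  have "curve G (fst s) ` {0<..<1} \<inter> verts G = {}" using pg assms by (simp add: plane_graph_def)
  moreover have "dcurve G s t \<in> curve G (fst s) ` {0<..<1}"
    using assms by (auto simp: dcurve_def reversepath_def split: prod.split)
  ultimately show ?thesis by blast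
qed

lemma common_point_of_edges:
  assumes "e \<in> edges G" "e' \<in> edges G" "e \<noteq> e'" "x \<in> path_image (curve G e)" "x \<in> path_image (curve G e')"
  shows "x \<in> verts G"
proof -
  have "path_image (curve G e) \<inter> path_image (curve G e') \<subseteq> verts G"
    using pg assms(1-3) by (simp add: plane_graph_def)
  then show ?thesis using assms by blast
qed

lemma armE:
  assumes "s \<in> spokes v" "x \<in> arm s" "x \<noteq> v"
  obtains t where "0 < t" "t < 1" "x = dcurve G s t" "x \<notin> verts G" "x \<in> path_image (curve G (fst s))"
proof -
  obtain t where t: "0 \<le> t" "t < 1" "x = dcurve G s t" using assms(2) by (auto simp: arm_def)
  have s: "fst s \<in> edges G" "dcurve G s 0 = v" using assms(1) by (auto simp: spokes_def pathstart_def)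
  have "t \<noteq> 0" using s(2) t(3) assms(3) by metis
  then have "0 < t" using t by simp
  moreover have "x \<in> path_image (dcurve G s)" using t by (auto simp: path_image_def)
  ultimately show ?thesis using that t dcurve_interior[OF s(1)] dcurve_arc(4)[OF s(1)] by simp
qed

lemma spoke_unique:
  assumes s: "s \<in> spokes v" and s': "s' \<in> spokes v" and e: "fst s = fst s'"
  shows "s = s'"
proof (rule ccontr)
  assume "s \<noteq> s'"
  then obtain e d where "s = (e, d)" "s' = (e, \<not> d)" using e by (cases s; cases s') auto
  then have "pathstart (curve G e) = pathfinish (curve G e)" "e \<in> edges G"
    using s s' by (cases d; auto simp: spokes_def dcurve_def)+
  moreover have "arc (curve G e)" using pg \<open>e \<in> edges G\<close> by (simp add: plane_graph_def)
  ultimately show False using arc_distinct_ends[of "curve G e"] by simp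
qed

lemma arms_meet:
  assumes "s \<in> spokes v" "s' \<in> spokes v" "s \<noteq> s'" "x \<in> arm s" "x \<in> arm s'"
  shows "x = v"
proof (rule ccontr)
  assume x: "x \<noteq> v"
  obtain "x \<notin> verts G" "x \<in> path_image (curve G (fst s))" using armE[OF assms(1,4) x] .
  moreover obtain "x \<in> path_image (curve G (fst s'))" using armE[OF assms(2,5) x] .
  moreover have "fst s \<noteq> fst s'" using spoke_unique assms by blast
  moreover have "fst s \<in> edges G" "fst s' \<in> edges G" using assms(1,2) by (simp_all add: spokes_def)
  ultimately show False using common_point_of_edges by metis
qed

lemma other_vertex_not_in_star:
  assumes "w \<in> verts G" "w \<noteq> v"
  shows "w \<notin> star v"
  using assms armE unfolding star_def by (metis UN_E insertE)

text \<open>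
  The complement of an open star in the graph is a finite union of points and closed arcs, which
  is why the star is open.
\<close>

lemma star_eq:
  assumes v: "v \<in> verts G"
  shows "star v = \<Gamma> - ((verts G - {v}) \<union> (\<Union>e\<in>{e \<in> edges G. \<forall>d. (e, d) \<notin> spokes v}. path_image (curve G e)))"
    (is "_ = _ - (_ \<union> ?far)")
proof (intro equalityI subsetI)
  fix x assume x: "x \<in> star v"
  have nv: "x \<notin> verts G - {v}" using x other_vertex_not_in_star by blast
  show "x \<in> \<Gamma> - ((verts G - {v}) \<union> ?far)"
  proof (cases "x = v")
    case True
    have "v \<notin> path_image (curve G e)" if e: "e \<in> edges G" "\<forall>d. (e, d) \<notin> spokes v" for e
    proof
      assume "v \<in> path_image (curve G e)"
      then obtain t where t: "0 \<le> t" "t \<le> 1" "v = curve G e t" by (auto simp: path_image_def)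
      have "t = 0 \<or> t = 1" using dcurve_interior[of "(e, True)" t] e(1) t v by (force simp: dcurve_def)
      then have "(e, True) \<in> spokes v \<or> (e, False) \<in> spokes v"
        using e(1) t(3) by (auto simp: spokes_def dcurve_def pathstart_def pathfinish_def reversepath_def)
      then show False using e(2) by blast
    qed
    then show ?thesis using True v by (auto simp: graph_set_def)
  next
    case False
    then obtain s where s: "s \<in> spokes v" "x \<in> arm s" using x by (auto simp: star_def)
    have xs: "x \<notin> verts G" "x \<in> path_image (curve G (fst s))" using armE[OF s False] by blast+
    have "fst s \<in> edges G" using s by (simp add: spokes_def)
    moreover have "x \<notin> ?far"
    proof
      assume "x \<in> ?far"
      then obtain e where e: "e \<in> edges G" "\<forall>d. (e, d) \<notin> spokes v" "x \<in> path_image (curve G e)" by blast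
      then have "e \<noteq> fst s" using s by (metis prod.collapse)
      then show False using common_point_of_edges[OF e(1) \<open>fst s \<in> edges G\<close> _ e(3) xs(2)] xs(1) by blast
    qed
    ultimately show ?thesis using xs nv by (auto simp: graph_set_def)
  qed
next
  fix x assume x: "x \<in> \<Gamma> - ((verts G - {v}) \<union> ?far)"
  show "x \<in> star v"
  proof (cases "x \<in> verts G")
    case True
    then show ?thesis using x by (auto simp: star_def)
  next
    case False
    then obtain e where e: "e \<in> edges G" "x \<in> path_image (curve G e)" using x by (auto simp: graph_set_def)
    then obtain d where d: "(e, d) \<in> spokes v" using x by blast
    have "x \<in> path_image (dcurve G (e, d))" using dcurve_arc(4)[of "(e, d)"] e by simp
    then obtain t where t: "0 \<le> t" "t \<le> 1" "x = dcurve G (e, d) t" by (auto simp: path_image_def)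
    have "t \<noteq> 1"
    proof
      assume "t = 1"
      then have "x = pathfinish (dcurve G (e, d))" using t by (simp add: pathfinish_def)
      then show False using False dcurve_arc(3)[of "(e, d)"] e by simp
    qed
    then have "x \<in> arm (e, d)" using t by (auto simp: arm_def)
    then show ?thesis using d unfolding star_def by blast
  qed
qed

lemma openin_star:
  assumes v: "v \<in> verts G"
  shows "openin (top_of_set \<Gamma>) (star v)"
proof -
  have "closed (path_image (curve G e))" if "e \<in> edges G" for e
    using that pg by (intro compact_imp_closed compact_path_image arc_imp_path) (simp add: plane_graph_def)
  then have "closed ((verts G - {v}) \<union> (\<Union>e\<in>{e \<in> edges G. \<forall>d. (e, d) \<notin> spokes v}. path_image (curve G e)))"
    using pg by (intro closed_Un closed_UN finite_imp_closed) (auto simp: plane_graph_def)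
  then have "openin (top_of_set \<Gamma>) (\<Gamma> \<inter> - ((verts G - {v}) \<union> (\<Union>e\<in>{e \<in> edges G. \<forall>d. (e, d) \<notin> spokes v}. path_image (curve G e))))"
    by (rule openin_open_Int[OF open_Compl])
  then show ?thesis
    unfolding star_eq[OF v] Diff_eq[of \<Gamma>] .
qed

lemma star_subset: "v \<in> verts G \<Longrightarrow> star v \<subseteq> \<Gamma>"
  using openin_star openin_imp_subset by blast

lemma stars_cover: "\<Gamma> \<subseteq> \<Union>(star ` verts G)"
proof
  fix x assume "x \<in> \<Gamma>"
  then consider "x \<in> verts G" | e where "e \<in> edges G" "x \<in> path_image (curve G e)" "x \<notin> verts G"
    unfolding graph_set_def by blast
  then show "x \<in> \<Union>(star ` verts G)"
  proof cases
    case 1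
    then show ?thesis by (auto simp: star_def)
  next
    case (2 e)
    let ?v = "pathstart (curve G e)"
    have v: "?v \<in> verts G" "(e, True) \<in> spokes ?v"
      using 2 pg by (auto simp: plane_graph_def spokes_def dcurve_def)
    have "x \<notin> path_image (curve G e')" if "e' \<in> edges G" "\<forall>d. (e', d) \<notin> spokes ?v" for e'
      using common_point_of_edges[OF that(1) 2(1) _ _ 2(2)] that v(2) 2(3) by blast
    then have "x \<in> star ?v" unfolding star_eq[OF v(1)] using \<open>x \<in> \<Gamma>\<close> 2(3) by auto
    then show ?thesis using v by blast
  qed
qed

lemma arm_eq:
  assumes s: "s \<in> spokes v"
  shows "arm s = star v \<inter> path_image (dcurve G s)"
proof (intro equalityI subsetI)
  fix x assume "x \<in> arm s"
  then show "x \<in> star v \<inter> path_image (dcurve G s)"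
    using s by (auto simp: star_def arm_def path_image_def)
next
  fix x assume x: "x \<in> star v \<inter> path_image (dcurve G s)"
  have e: "fst s \<in> edges G" "pathstart (dcurve G s) = v" using s by (auto simp: spokes_def)
  have "pathfinish (dcurve G s) \<noteq> v" using arc_distinct_ends[OF dcurve_arc(1)[OF e(1)]] e(2) by simp
  then have "pathfinish (dcurve G s) \<notin> star v" using other_vertex_not_in_star dcurve_arc(3)[OF e(1)] by blast
  moreover obtain t where t: "0 \<le> t" "t \<le> 1" "x = dcurve G s t" using x by (auto simp: path_image_def)
  ultimately have "t \<noteq> 1" using x by (auto simp: pathfinish_def)
  then show "x \<in> arm s" using t by (auto simp: arm_def)
qed

text \<open>
  Each arm retracts to its start by shrinking the parameter of its arc.  The arms are finitely many
  relatively closed subsets of the star, so the retractions can be pasted.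
\<close>

lemma contractible_star: "contractible (star v)"
proof (cases "spokes v = {}")
  case True
  then show ?thesis by (simp add: star_def)
next
  case False
  have "\<exists>h. homeomorphism {0..1} (path_image (dcurve G s)) (dcurve G s) h" if "s \<in> spokes v" for s
    using that homeomorphism_arc[OF dcurve_arc(1)] by (metis (mono_tags, lifting) mem_Collect_eq spokes_def)
  then obtain h where h: "\<And>s. s \<in> spokes v \<Longrightarrow> homeomorphism {0..1} (path_image (dcurve G s)) (dcurve G s) (h s)"
    by metis
  have start: "dcurve G s 0 = v" if "s \<in> spokes v" for s using that by (simp add: spokes_def pathstart_def)
  have hv: "h s v = 0" if "s \<in> spokes v" for s
    using homeomorphism_apply1[OF h[OF that], of 0] start[OF that] by simp
  have h01: "h s x \<in> {0..<1}" "dcurve G s (h s x) = x" if s: "s \<in> spokes v" and x: "x \<in> arm s" for s x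
  proof -
    obtain t where t: "t \<in> {0..<1}" "x = dcurve G s t" using x by (auto simp: arm_def)
    then show "h s x \<in> {0..<1}" "dcurve G s (h s x) = x" using homeomorphism_apply1[OF h[OF s], of t] by auto
  qed
  define f where "f s = (\<lambda>p. dcurve G s ((1 - fst p) * h s (snd p)))" for s
  let ?X = "{0..1::real} \<times> star v"
  have v_arm: "v \<in> arm s" if "s \<in> spokes v" for s
    using start[OF that] by (force simp: arm_def)
  then have starU: "star v = (\<Union>s\<in>spokes v. arm s)" using False by (auto simp: star_def)
  have arm_closed: "closedin (top_of_set ?X) ({0..1} \<times> arm s)" if s: "s \<in> spokes v" for s
  proof -
    have "{0..1} \<times> arm s = ?X \<inter> (UNIV \<times> path_image (dcurve G s))"
      using arm_eq[OF s] by auto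
    moreover have "closed (UNIV \<times> path_image (dcurve G s) :: (real \<times> complex) set)"
      using s dcurve_arc(1)[of s]
      by (intro closed_Times closed_UNIV compact_imp_closed compact_path_image arc_imp_path) (simp add: spokes_def)
    ultimately show ?thesis by (metis closedin_closed_Int)
  qed
  have f_arm: "f s (\<tau>, x) \<in> arm s" if "s \<in> spokes v" "x \<in> arm s" "\<tau> \<in> {0..1}" for s \<tau> x
  proof -
    have "(1 - \<tau>) * h s x \<le> 1 * h s x" using h01(1)[OF that(1,2)] that(3) by (intro mult_right_mono) auto
    then have "(1 - \<tau>) * h s x \<in> {0..<1}" using h01(1)[OF that(1,2)] that(3) by auto
    then show ?thesis unfolding f_def arm_def by auto
  qed
  have f_cont: "continuous_map (subtopology (top_of_set ?X) ({0..1} \<times> arm s)) (top_of_set (star v)) (f s)"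
    if s: "s \<in> spokes v" for s
  proof -
    have "subtopology (top_of_set ?X) ({0..1} \<times> arm s) = top_of_set ({0..1} \<times> arm s)"
      using arm_eq[OF s] by (simp add: subtopology_subtopology Int_absorb1 Sigma_mono)
    moreover have "continuous_on ({0..1::real} \<times> arm s) (f s)"
    proof -
      have hc: "continuous_on (arm s) (h s)"
        using homeomorphism_cont2[OF h[OF s]] by (rule continuous_on_subset) (use arm_eq[OF s] in blast)
      have gc: "continuous_on {0..1} (dcurve G s)" by (rule homeomorphism_cont1[OF h[OF s]])
      show ?thesis
        unfolding f_def
      proof (rule continuous_on_compose2[OF gc])
        show "continuous_on ({0..1::real} \<times> arm s) (\<lambda>p. (1 - fst p) * h s (snd p))"
          by (intro continuous_intros continuous_on_compose2[OF hc]) auto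
        show "(\<lambda>p. (1 - fst p) * h s (snd p)) ` ({0..1::real} \<times> arm s) \<subseteq> {0..1}"
        proof (rule image_subsetI)
          fix p assume p: "p \<in> {0..1::real} \<times> arm s"
          then have "h s (snd p) \<in> {0..<1}" using h01[OF s] by auto
          then show "(1 - fst p) * h s (snd p) \<in> {0..1}"
            using p by (auto intro!: mult_le_one)
        qed
      qed
    qed
    moreover have "f s ` ({0..1} \<times> arm s) \<subseteq> star v"
      using f_arm[OF s] arm_eq[OF s] by auto
    ultimately show ?thesis by (auto simp: image_subset_iff_funcset)
  qed
  have "\<exists>H. continuous_map (top_of_set ?X) (top_of_set (star v)) H \<and>
      (\<forall>s p. s \<in> spokes v \<longrightarrow> p \<in> ?X \<inter> ({0..1} \<times> arm s) \<longrightarrow> H p = f s p)"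
  proof -
    have agree: "f i p = f j p" if "i \<in> spokes v" "j \<in> spokes v"
      "p \<in> topspace (top_of_set ?X) \<inter> ({0..1} \<times> arm i) \<inter> ({0..1} \<times> arm j)" for i j p
    proof (cases "i = j")
      case False
      then have "snd p = v" using arms_meet[OF that(1,2) False, of "snd p"] that(3) by auto
      then show ?thesis using that(1,2) by (simp add: f_def hv start)
    qed simp
    obtain H where "continuous_map (top_of_set ?X) (top_of_set (star v)) H"
      "\<And>p s. \<lbrakk>s \<in> spokes v; p \<in> topspace (top_of_set ?X) \<inter> ({0..1} \<times> arm s)\<rbrakk> \<Longrightarrow> H p = f s p"
      by (rule pasting_lemma_exists_closed[OF finite_spokes[of v] _ arm_closed f_cont agree])
        (use starU in auto)
    then show ?thesis by auto
  qed
  then obtain H where cm: "continuous_map (top_of_set ?X) (top_of_set (star v)) H"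
    and agree: "\<And>s p. s \<in> spokes v \<Longrightarrow> p \<in> ?X \<inter> ({0..1} \<times> arm s) \<Longrightarrow> H p = f s p" by blast
  have H: "continuous_on ?X H" "H ` ?X \<subseteq> star v" using cm by (auto simp: image_subset_iff_funcset)
  have Hf: "H (\<tau>, x) = f s (\<tau>, x)" if "s \<in> spokes v" "x \<in> arm s" "\<tau> \<in> {0..1}" for s \<tau> x
    using that arm_eq[OF that(1)] by (intro agree) auto
  have H01: "H (0, x) = x" "H (1, x) = v" if x: "x \<in> star v" for x
  proof -
    obtain s where s: "s \<in> spokes v" "x \<in> arm s" using x unfolding starU by blast
    show "H (0, x) = x" "H (1, x) = v" using Hf[OF s] h01(2)[OF s] start[OF s(1)] by (auto simp: f_def)
  qed
  have "homotopic_with_canon (\<lambda>x. True) (star v) (star v) id (\<lambda>x. v)"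
  proof (subst homotopic_with)
    show "\<exists>h. continuous_map (prod_topology (top_of_set {0..1::real}) (top_of_set (star v))) (top_of_set (star v)) h \<and>
        (\<forall>x\<in>topspace (top_of_set (star v)). h (0, x) = id x) \<and>
        (\<forall>x\<in>topspace (top_of_set (star v)). h (1, x) = v) \<and> (\<forall>t\<in>{0..1::real}. True)"
      using H H01 by (intro exI[of _ H]) (auto simp: image_subset_iff_funcset)
  qed simp
  then show ?thesis unfolding contractible_def by blast
qed

lemma simply_connected_star: "simply_connected (star v)"
  by (rule contractible_imp_simply_connected[OF contractible_star])

definition walk_curve :: "complex \<Rightarrow> ('e \<times> bool) list \<Rightarrow> real \<Rightarrow> complex" where
  "walk_curve w ls = foldr (\<lambda>s p. dcurve G s +++ p) ls (linepath w w)"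

lemma walk_curve_Nil: "walk_curve w [] = linepath w w"
  by (simp only: walk_curve_def foldr.simps id_apply)

lemma plane_walk_curve: "plane \<circ> walk_curve w ls = walk_path G w ls"
proof (induction ls)
  case Nil
  show ?case by (simp add: walk_curve_def walk_path_def linepath_refl o_def)
next
  case (Cons s ls)
  have "walk_curve w (s # ls) = dcurve G s +++ walk_curve w ls"
    "walk_path G w (s # ls) = (plane \<circ> dcurve G s) +++ walk_path G w ls"
    by (simp_all add: walk_curve_def walk_path_def)
  then show ?case by (simp only: path_compose_join Cons.IH)
qed

lemma edge_between: "fst s \<in> edges G \<Longrightarrow> path_between \<Gamma> (pathstart (dcurve G s)) (pathfinish (dcurve G s)) (dcurve G s)"
  using dcurve_arc[of s] by (auto simp: path_between_def arc_imp_path graph_set_def)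

lemma walk_curve_between: "edge_walk G v ls w \<Longrightarrow> path_between \<Gamma> v w (walk_curve w ls)"
proof (induction ls arbitrary: v)
  case Nil
  then have "v = w" "w \<in> \<Gamma>" by (auto simp: graph_set_def)
  then show ?case unfolding walk_curve_Nil using path_between_refl by blast
next
  case (Cons s ls)
  have s: "fst s \<in> edges G" "pathstart (dcurve G s) = v" and w: "edge_walk G (pathfinish (dcurve G s)) ls w"
    using Cons.prems by auto
  show ?case
    using path_between_join[OF edge_between[OF s(1)] Cons.IH[OF w]] s(2) by (simp add: walk_curve_def)
qed

lemma edge_walk_append:
  "edge_walk G u ls v \<Longrightarrow> edge_walk G v ls' w \<Longrightarrow> edge_walk G u (ls @ ls') w"
  by (induction ls arbitrary: u) auto

lemma walk_curve_append:
  "edge_walk G u ls v \<Longrightarrow> edge_walk G v ls' w \<Longrightarrow>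
    homotopic_paths \<Gamma> (walk_curve v ls +++ walk_curve w ls') (walk_curve w (ls @ ls'))"
proof (induction ls arbitrary: u)
  case Nil
  have "homotopic_paths \<Gamma> (linepath v v +++ walk_curve w ls') (walk_curve w ls')"
    using walk_curve_between[OF Nil(2)] by (intro homotopic_paths_lid') (auto simp: path_between_def)
  then show ?case by (simp only: append_Nil walk_curve_Nil)
next
  case (Cons s ls)
  note [trans] = homotopic_paths_trans
  have s: "fst s \<in> edges G" and l: "edge_walk G (pathfinish (dcurve G s)) ls v"
    using Cons.prems by auto
  have simps: "walk_curve v (s # ls) = dcurve G s +++ walk_curve v ls"
    "walk_curve w ((s # ls) @ ls') = dcurve G s +++ walk_curve w (ls @ ls')"
    by (simp_all add: walk_curve_def)
  note b = edge_between[OF s] walk_curve_between[OF l] walk_curve_between[OF Cons.prems(2)]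
  have "homotopic_paths \<Gamma> (walk_curve v (s # ls) +++ walk_curve w ls') (dcurve G s +++ (walk_curve v ls +++ walk_curve w ls'))"
    unfolding simps by (rule homotopic_assoc[OF b])
  also have "homotopic_paths \<Gamma> \<dots> (dcurve G s +++ walk_curve w (ls @ ls'))"
    by (rule homotopic_join_right[OF Cons.IH[OF l Cons.prems(2)] b(1) path_between_join[OF b(2,3)]])
  finally show ?case unfolding simps .
qed

text \<open>
  The local form of the claim about walks: \<open>\<delta>\<close> and \<open>\<delta>'\<close> join vertices \<open>v\<close> and \<open>w\<close> to the ends of
  \<open>p\<close>, and up to homotopy \<open>p\<close> carries \<open>\<delta>\<close> to \<open>\<delta>'\<close> at the price of an edge walk.  In this form the
  claim makes sense for paths that are not loops at vertices, and it can be composed.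
\<close>

definition walk_shift :: "complex \<Rightarrow> complex \<Rightarrow> (real \<Rightarrow> complex) \<Rightarrow> (real \<Rightarrow> complex) \<Rightarrow> (real \<Rightarrow> complex) \<Rightarrow> bool" where
  "walk_shift v w \<delta> p \<delta>' \<longleftrightarrow> (\<exists>ls. edge_walk G v ls w \<and> homotopic_paths \<Gamma> (\<delta> +++ p) (walk_curve w ls +++ \<delta>'))"

lemma walk_shift_join:
  assumes 1: "walk_shift u v \<delta> p \<delta>'" and 2: "walk_shift v w \<delta>' q \<delta>''"
    and b: "path_between \<Gamma> u a \<delta>" "path_between \<Gamma> v b \<delta>'" "path_between \<Gamma> w c \<delta>''"
      "path_between \<Gamma> a b p" "path_between \<Gamma> b c q"
  shows "walk_shift u w \<delta> (p +++ q) \<delta>''"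
proof -
  note [trans] = homotopic_paths_trans
  obtain ls where ls: "edge_walk G u ls v" "homotopic_paths \<Gamma> (\<delta> +++ p) (walk_curve v ls +++ \<delta>')"
    using 1 by (auto simp: walk_shift_def)
  obtain ls' where ls': "edge_walk G v ls' w" "homotopic_paths \<Gamma> (\<delta>' +++ q) (walk_curve w ls' +++ \<delta>'')"
    using 2 by (auto simp: walk_shift_def)
  note g = walk_curve_between[OF ls(1)] and g' = walk_curve_between[OF ls'(1)]
  have "homotopic_paths \<Gamma> (\<delta> +++ (p +++ q)) ((\<delta> +++ p) +++ q)"
    by (rule homotopic_paths_sym[OF homotopic_assoc[OF b(1,4,5)]])
  also have "homotopic_paths \<Gamma> \<dots> ((walk_curve v ls +++ \<delta>') +++ q)"
    by (rule homotopic_join_left[OF ls(2) path_between_join[OF b(1,4)] b(5)])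
  also have "homotopic_paths \<Gamma> \<dots> (walk_curve v ls +++ (\<delta>' +++ q))"
    by (rule homotopic_assoc[OF g b(2,5)])
  also have "homotopic_paths \<Gamma> \<dots> (walk_curve v ls +++ (walk_curve w ls' +++ \<delta>''))"
    by (rule homotopic_join_right[OF ls'(2) g path_between_join[OF b(2,5)]])
  also have "homotopic_paths \<Gamma> \<dots> ((walk_curve v ls +++ walk_curve w ls') +++ \<delta>'')"
    by (rule homotopic_paths_sym[OF homotopic_assoc[OF g g' b(3)]])
  also have "homotopic_paths \<Gamma> \<dots> (walk_curve w (ls @ ls') +++ \<delta>'')"
    by (rule homotopic_join_left[OF walk_curve_append[OF ls(1) ls'(1)] path_between_join[OF g g'] b(3)])
  finally show ?thesis
    using edge_walk_append[OF ls(1) ls'(1)] unfolding walk_shift_def by blast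
qed

lemma walk_shift_homotopic:
  assumes "walk_shift u v \<delta> p \<delta>'" "homotopic_paths \<Gamma> p q" "path_between \<Gamma> u a \<delta>" "path_between \<Gamma> a b p"
  shows "walk_shift u v \<delta> q \<delta>'"
proof -
  have "homotopic_paths \<Gamma> (\<delta> +++ q) (\<delta> +++ p)"
    by (rule homotopic_paths_sym[OF homotopic_join_right[OF assms(2-4)]])
  then show ?thesis using assms(1) homotopic_paths_trans unfolding walk_shift_def by blast
qed

lemma walk_shift_in_star:
  assumes v: "v \<in> verts G" and \<delta>: "path_between (star v) v a \<delta>" and p: "path_between (star v) a b p"
    and \<delta>': "path_between (star v) v b \<delta>'"
  shows "walk_shift v v \<delta> p \<delta>'"
proof -
  have "path_between (star v) v v (linepath v v)" by (rule path_between_refl) (simp add: star_def)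
  then have "homotopic_paths \<Gamma> (\<delta> +++ p) (linepath v v +++ \<delta>')"
    using simply_connected_homotopic[OF simply_connected_star star_subset[OF v] path_between_join[OF \<delta> p]] \<delta>' path_between_join
    by blast
  then show ?thesis
    using v unfolding walk_shift_def by (intro exI[of _ "[]"]) (simp add: walk_curve_def)
qed

text \<open>
  A point in the stars of two different vertices lies inside an edge \<open>s\<close> from one to the other.  Up
  to homotopy \<open>\<delta>\<close> is the initial piece of that edge and \<open>\<delta>'\<close> the final piece backwards, so \<open>\<delta>\<close> is
  the whole edge followed by \<open>\<delta>'\<close>.
\<close>

lemma walk_shift_between_stars:
  assumes v: "v \<in> verts G" and w: "w \<in> verts G"
    and \<delta>: "path_between (star v) v x \<delta>" and \<delta>': "path_between (star w) w x \<delta>'"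
  shows "walk_shift v w \<delta> (linepath x x) \<delta>'"
proof (cases "v = w")
  case True
  have "x \<in> star v" using path_betweenD(6)[OF \<delta>] .
  then show ?thesis using walk_shift_in_star[OF v \<delta> path_between_refl] \<delta>' True by simp
next
  case False
  note [trans] = homotopic_paths_trans
  have xv: "x \<in> star v" and xw: "x \<in> star w" using path_betweenD(6)[OF \<delta>] path_betweenD(6)[OF \<delta>'] .
  have "x \<noteq> v" "x \<noteq> w"
    using xv xw other_vertex_not_in_star[OF v] other_vertex_not_in_star[OF w] False by auto
  then obtain s s' where s: "s \<in> spokes v" "x \<in> arm s" and s': "s' \<in> spokes w" "x \<in> arm s'"
    using xv xw by (auto simp: star_def)
  obtain t where t: "0 < t" "t < 1" "x = dcurve G s t" "x \<notin> verts G" "x \<in> path_image (curve G (fst s))"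
    using armE[OF s \<open>x \<noteq> v\<close>] .
  obtain t' where t': "x \<in> path_image (curve G (fst s'))"
    using armE[OF s' \<open>x \<noteq> w\<close>] .
  have e: "fst s \<in> edges G" "pathstart (dcurve G s) = v" "fst s' \<in> edges G" "pathstart (dcurve G s') = w"
    using s s' by (simp_all add: spokes_def)
  have same: "fst s = fst s'" using common_point_of_edges[OF e(1,3) _ t(5) t'] t(4) by blast
  have "snd s \<noteq> snd s'"
  proof
    assume "snd s = snd s'"
    then have "s = s'" using same by (simp add: prod_eq_iff)
    then show False using e(2,4) False by simp
  qed
  then have rev: "dcurve G s' = reversepath (dcurve G s)"
    using same by (cases s; cases s'; cases "snd s") (auto simp: dcurve_def)
  then have fin: "pathfinish (dcurve G s) = w" using e(4) by simp
  let ?g = "dcurve G s"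
  have g: "path ?g" "path_image ?g \<subseteq> \<Gamma>" using edge_between[OF e(1)] by (auto simp: path_between_def)
  have g01: "?g 0 = v" "?g 1 = w" using e(2) fin by (auto simp: pathstart_def pathfinish_def)
  have arm_star: "arm s \<subseteq> star v" "arm s' \<subseteq> star w" using s s' by (auto simp: star_def)
  have s0: "path_between (star v) v x (subpath 0 t ?g)"
  proof -
    have "?g r \<in> star v" if "r \<in> {0..t}" for r using that t arm_star(1) by (auto simp: arm_def)
    then show ?thesis using g t g01 by (auto simp: path_between_def path_image_subpath)
  qed
  have s1: "path_between (star w) w x (subpath 1 t ?g)"
  proof -
    have "?g r \<in> star w" if "r \<in> {t..1}" for r
    proof -
      have "?g r = dcurve G s' (1 - r)" by (simp add: rev reversepath_def)
      then show ?thesis using that t arm_star(2) by (auto simp: arm_def)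
    qed
    then show ?thesis using g t g01 by (auto simp: path_between_def path_image_subpath)
  qed
  have walk: "edge_walk G v [s] w" using e fin w by simp
  have wc: "walk_curve w [s] = ?g +++ linepath w w" by (simp add: walk_curve_def)
  note sub = path_between_mono[OF _ star_subset[OF v]] path_between_mono[OF _ star_subset[OF w]]
  have gb: "path_between \<Gamma> v w ?g" using edge_between[OF e(1)] e(2) fin by simp
  have "homotopic_paths \<Gamma> (\<delta> +++ linepath x x) \<delta>"
    using sub(1)[OF \<delta>] by (intro homotopic_paths_rid') (auto simp: path_between_def)
  also have "homotopic_paths \<Gamma> \<delta> (subpath 0 t ?g)"
    by (rule simply_connected_homotopic[OF simply_connected_star star_subset[OF v] \<delta> s0])
  also have "homotopic_paths \<Gamma> \<dots> (subpath 0 1 ?g +++ subpath 1 t ?g)"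
    using g t by (intro homotopic_paths_sym[OF homotopic_join_subpaths]) auto
  also have "subpath 0 1 ?g = ?g" by simp
  also have "homotopic_paths \<Gamma> (?g +++ subpath 1 t ?g) (?g +++ \<delta>')"
    by (rule homotopic_join_right[OF simply_connected_homotopic[OF simply_connected_star star_subset[OF w] s1 \<delta>'] gb sub(2)[OF s1]])
  also have "homotopic_paths \<Gamma> \<dots> (walk_curve w [s] +++ \<delta>')"
  proof (rule homotopic_join_left[OF _ gb sub(2)[OF \<delta>']])
    show "homotopic_paths \<Gamma> ?g (walk_curve w [s])"
      unfolding wc using gb by (intro homotopic_paths_sym[OF homotopic_paths_rid']) (auto simp: path_between_def)
  qed
  finally show ?thesis using walk unfolding walk_shift_def by blast
qed

text \<open>
  A path inside the star of \<open>u\<close> is handled by passing from the star of \<open>v\<close> to that of \<open>u\<close> at its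
  start, and from the star of \<open>u\<close> to that of \<open>w\<close> at its end.  The quantification over all choices of
  \<open>v\<close>, \<open>w\<close>, \<open>\<delta>\<close> and \<open>\<delta>'\<close> in \<open>\<Phi>\<close> makes the property multiplicative.
\<close>

lemma path_walk_shift:
  assumes p: "path p" "path_image p \<subseteq> \<Gamma>"
    and v: "v \<in> verts G" "path_between (star v) v (pathstart p) \<delta>"
    and w: "w \<in> verts G" "path_between (star w) w (pathfinish p) \<delta>'"
  shows "walk_shift v w \<delta> p \<delta>'"
proof -
  define \<Phi> where "\<Phi> p \<longleftrightarrow> (\<forall>v w \<delta> \<delta>'. v \<in> verts G \<longrightarrow> path_between (star v) v (pathstart p) \<delta> \<longrightarrow>
    w \<in> verts G \<longrightarrow> path_between (star w) w (pathfinish p) \<delta>' \<longrightarrow> walk_shift v w \<delta> p \<delta>')" for p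
  have star_path: "\<exists>\<delta>. path_between (star u) u a \<delta>" if "a \<in> star u" for u a
    using path_connected_between[OF simply_connected_imp_path_connected[OF simply_connected_star] _ that, of u]
    by (auto simp: star_def)
  have "\<Phi> p"
  proof (rule path_local_to_global[OF p, where \<U> = "star ` verts G"])
    show "\<And>U. U \<in> star ` verts G \<Longrightarrow> openin (top_of_set \<Gamma>) U" using openin_star by blast
    show "\<Gamma> \<subseteq> \<Union>(star ` verts G)" by (rule stars_cover)
  next
    fix q U assume U: "U \<in> star ` verts G" and q: "path q" "path_image q \<subseteq> U"
    then obtain u where u: "u \<in> verts G" "U = star u" by blast
    let ?a = "pathstart q" and ?b = "pathfinish q"
    have qu: "path_between (star u) ?a ?b q" using q u by (simp add: path_between_def)
    obtain \<eta> \<eta>' where \<eta>: "path_between (star u) u ?a \<eta>" and \<eta>': "path_between (star u) u ?b \<eta>'"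
      using star_path[OF path_betweenD(5)[OF qu]] star_path[OF path_betweenD(6)[OF qu]] by blast
    note sub = path_between_mono[OF _ star_subset]
    note q\<Gamma> = sub[OF qu u(1)]
    have ca: "path_between \<Gamma> ?a ?a (linepath ?a ?a)" and cb: "path_between \<Gamma> ?b ?b (linepath ?b ?b)"
      by (rule path_between_refl[OF path_betweenD(5)[OF q\<Gamma>]], rule path_between_refl[OF path_betweenD(6)[OF q\<Gamma>]])
    show "\<Phi> q" unfolding \<Phi>_def
    proof (intro allI impI)
      fix v w \<delta> \<delta>' assume v: "v \<in> verts G" "path_between (star v) v ?a \<delta>"
        and w: "w \<in> verts G" "path_between (star w) w ?b \<delta>'"
      note b = sub[OF v(2,1)] sub[OF \<eta> u(1)] sub[OF \<eta>' u(1)] sub[OF w(2,1)]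
      have 1: "walk_shift v u \<delta> (linepath ?a ?a) \<eta>" by (rule walk_shift_between_stars[OF v(1) u(1) v(2) \<eta>])
      have 2: "walk_shift u u \<eta> q \<eta>'" by (rule walk_shift_in_star[OF u(1) \<eta> qu \<eta>'])
      have 3: "walk_shift u w \<eta>' (linepath ?b ?b) \<delta>'" by (rule walk_shift_between_stars[OF u(1) w(1) \<eta>' w(2)])
      have 12: "walk_shift v u \<delta> (linepath ?a ?a +++ q) \<eta>'"
        by (rule walk_shift_join[OF 1 2 b(1,2,3) ca q\<Gamma>])
      have 123: "walk_shift v w \<delta> ((linepath ?a ?a +++ q) +++ linepath ?b ?b) \<delta>'"
        by (rule walk_shift_join[OF 12 3 b(1,3,4) path_between_join[OF ca q\<Gamma>] cb])
      have "homotopic_paths \<Gamma> ((linepath ?a ?a +++ q) +++ linepath ?b ?b) (linepath ?a ?a +++ q)"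
        using path_between_join[OF ca q\<Gamma>] by (intro homotopic_paths_rid') (auto simp: path_between_def)
      moreover have "homotopic_paths \<Gamma> (linepath ?a ?a +++ q) q"
        using q\<Gamma> by (intro homotopic_paths_lid') (auto simp: path_between_def)
      ultimately have "homotopic_paths \<Gamma> ((linepath ?a ?a +++ q) +++ linepath ?b ?b) q"
        by (rule homotopic_paths_trans)
      then show "walk_shift v w \<delta> q \<delta>'"
        by (rule walk_shift_homotopic[OF 123 _ b(1) path_between_join[OF path_between_join[OF ca q\<Gamma>] cb]])
    qed
  next
    fix q r a b c
    assume q: "path_between \<Gamma> a b q" and r: "path_between \<Gamma> b c r" and \<Phi>: "\<Phi> q" "\<Phi> r"
    have ends: "pathstart q = a" "pathfinish q = b" "pathstart r = b" "pathfinish r = c"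
      using q r by (auto simp: path_between_def)
    obtain u where u: "u \<in> verts G" "b \<in> star u"
      using stars_cover path_betweenD(6)[OF q] by blast
    obtain \<eta> where \<eta>: "path_between (star u) u b \<eta>" using star_path[OF u(2)] by blast
    note sub = path_between_mono[OF _ star_subset]
    show "\<Phi> (q +++ r)" unfolding \<Phi>_def pathstart_join pathfinish_join ends
    proof (intro allI impI)
      fix v w \<delta> \<delta>' assume v: "v \<in> verts G" "path_between (star v) v a \<delta>"
        and w: "w \<in> verts G" "path_between (star w) w c \<delta>'"
      have 1: "walk_shift v u \<delta> q \<eta>" using \<Phi>(1) v u \<eta> unfolding \<Phi>_def ends by simp
      have 2: "walk_shift u w \<eta> r \<delta>'" using \<Phi>(2) w u \<eta> unfolding \<Phi>_def ends by simp
      show "walk_shift v w \<delta> (q +++ r) \<delta>'"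
        by (rule walk_shift_join[OF 1 2 sub[OF v(2,1)] sub[OF \<eta> u(1)] sub[OF w(2,1)] q r])
    qed
  next
    fix q r assume h: "homotopic_paths \<Gamma> q r" and \<Phi>: "\<Phi> q"
    have ends: "pathstart r = pathstart q" "pathfinish r = pathfinish q"
      using homotopic_paths_imp_pathstart[OF h] homotopic_paths_imp_pathfinish[OF h] by simp_all
    have q: "path_between \<Gamma> (pathstart q) (pathfinish q) q"
      using homotopic_paths_imp_path[OF h] homotopic_paths_imp_subset[OF h] by (simp add: path_between_def)
    show "\<Phi> r" unfolding \<Phi>_def ends
    proof (intro allI impI)
      fix v w \<delta> \<delta>' assume v: "v \<in> verts G" "path_between (star v) v (pathstart q) \<delta>"
        and w: "w \<in> verts G" "path_between (star w) w (pathfinish q) \<delta>'"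
      have "walk_shift v w \<delta> q \<delta>'" using \<Phi> v w unfolding \<Phi>_def by simp
      then show "walk_shift v w \<delta> r \<delta>'"
        by (rule walk_shift_homotopic[OF _ h path_between_mono[OF v(2) star_subset[OF v(1)]] q])
    qed
  qed
  then show ?thesis using v w unfolding \<Phi>_def by simp
qed

lemma loop_homotopic_walk:
  assumes p: "path_between \<Gamma> x x p" and x: "x \<in> verts G"
  shows "\<exists>ls. edge_walk G x ls x \<and> homotopic_paths \<Gamma> p (walk_curve x ls)"
proof -
  note [trans] = homotopic_paths_trans
  have c: "path_between (star x) x x (linepath x x)" by (rule path_between_refl) (simp add: star_def)
  have "walk_shift x x (linepath x x) p (linepath x x)"
    using p c x by (intro path_walk_shift) (auto simp: path_between_def)
  then obtain ls where ls: "edge_walk G x ls x" "homotopic_paths \<Gamma> (linepath x x +++ p) (walk_curve x ls +++ linepath x x)"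
    by (auto simp: walk_shift_def)
  have "homotopic_paths \<Gamma> p (linepath x x +++ p)"
    using p by (intro homotopic_paths_sym[OF homotopic_paths_lid']) (auto simp: path_between_def)
  also note ls(2)
  also have "homotopic_paths \<Gamma> (walk_curve x ls +++ linepath x x) (walk_curve x ls)"
    using walk_curve_between[OF ls(1)] by (intro homotopic_paths_rid') (auto simp: path_between_def)
  finally show ?thesis using ls(1) by blast
qed

end

section \<open>Stereographic coordinates\<close>

definition unstereo :: "space4 \<Rightarrow> space3" where
  "unstereo q = (1 / (1 - snd q)) *\<^sub>R fst q"

lemma snd_stereo_neq_1: "snd (stereo p) \<noteq> 1"
proof -
  have "(norm p)\<^sup>2 + 1 > 0" by (simp add: add_nonneg_pos)
  then show ?thesis by (simp add: stereo_def field_simps)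
qed

lemma unstereo_stereo [simp]: "unstereo (stereo p) = p"
proof -
  have "(norm p)\<^sup>2 + 1 > 0" by (simp add: add_nonneg_pos)
  then have "1 / (1 - ((norm p)\<^sup>2 - 1) / ((norm p)\<^sup>2 + 1)) * (2 / ((norm p)\<^sup>2 + 1)) = 1"
    by (simp add: field_simps)
  then show ?thesis by (simp only: unstereo_def stereo_def fst_conv snd_conv scaleR_scaleR scaleR_one)
qed

lemma inj_stereo: "inj stereo"
  by (metis injI unstereo_stereo)

lemma stereo_in_S3: "stereo p \<in> S3"
proof -
  let ?n = "(norm p)\<^sup>2"
  have pos: "?n + 1 > 0" by (simp add: add_nonneg_pos)
  have "(norm (stereo p))\<^sup>2 = (2 / (?n + 1))\<^sup>2 * ?n + ((?n - 1) / (?n + 1))\<^sup>2"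
    by (simp add: stereo_def norm_Pair power_mult_distrib power_divide)
  also have "\<dots> = (4 * ?n + (?n - 1)\<^sup>2) / (?n + 1)\<^sup>2"
    by (simp add: power_divide add_divide_distrib)
  also have "4 * ?n + (?n - 1)\<^sup>2 = (?n + 1)\<^sup>2"
    by (simp add: power2_eq_square algebra_simps)
  also have "(?n + 1)\<^sup>2 / (?n + 1)\<^sup>2 = 1" using pos by simp
  finally show ?thesis by (simp add: S3_def power2_eq_1_iff) (smt (verit) norm_ge_zero)
qed

lemma stereo_unstereo:
  assumes "q \<in> S3" "snd q \<noteq> 1"
  shows "stereo (unstereo q) = q"
proof -
  obtain p r where q: "q = (p, r)" by fastforce
  have r: "r \<noteq> 1" using assms q by simp
  have "(norm q)\<^sup>2 = 1" using assms by (simp add: S3_def)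
  then have n: "(norm p)\<^sup>2 = 1 - r\<^sup>2" by (simp add: q norm_Pair)
  have u: "unstereo q = (1 / (1 - r)) *\<^sub>R p" by (simp add: unstereo_def q)
  have "(norm (unstereo q))\<^sup>2 = (1 - r\<^sup>2) / (1 - r)\<^sup>2"
    by (simp add: u power_divide n)
  also have "\<dots> = (1 + r) / (1 - r)"
  proof -
    have sq: "1 - r\<^sup>2 = (1 + r) * (1 - r)" by (simp add: power2_eq_square algebra_simps)
    show ?thesis unfolding sq unfolding power2_eq_square using r by simp
  qed
  finally have nu: "(norm (unstereo q))\<^sup>2 = (1 + r) / (1 - r)" .
  have a: "(norm (unstereo q))\<^sup>2 + 1 = 2 / (1 - r)" and b: "(norm (unstereo q))\<^sup>2 - 1 = 2 * r / (1 - r)"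
    unfolding nu using r by (simp_all add: field_simps)
  show ?thesis
    unfolding stereo_def a b unfolding u using r by (simp add: q)
qed

lemma continuous_on_stereo [continuous_intros]: "continuous_on A f \<Longrightarrow> continuous_on A (\<lambda>x. stereo (f x))"
  unfolding stereo_def
  by (intro continuous_intros) (auto simp: add_nonneg_eq_0_iff)

lemma continuous_plane: "continuous_on A plane"
  unfolding plane_def by (intro continuous_intros)

lemma continuous_on_unstereo: "continuous_on {q. snd q \<noteq> 1} unstereo"
  unfolding unstereo_def by (intro continuous_intros) auto

lemma above_eq: "above = stereo ` {p. snd p > 0}" and below_eq: "below = stereo ` {p. snd p < 0}"
proof -
  have sgn: "snd (fst (stereo p)) > 0 \<longleftrightarrow> snd p > 0" "snd (fst (stereo p)) < 0 \<longleftrightarrow> snd p < 0" for p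
  proof -
    have h: "snd (fst (stereo p)) = 2 / ((norm p)\<^sup>2 + 1) * snd p" by (simp add: stereo_def)
    have pos: "2 / ((norm p)\<^sup>2 + 1) > 0" by (simp add: add_nonneg_pos)
    show "snd (fst (stereo p)) > 0 \<longleftrightarrow> snd p > 0" "snd (fst (stereo p)) < 0 \<longleftrightarrow> snd p < 0"
      unfolding h using mult_less_cancel_left_pos[OF pos, of 0 "snd p"] mult_less_cancel_left_pos[OF pos, of "snd p" 0]
      by (simp_all only: mult_zero_right) 
  qed
  have ex: "\<exists>p. q = stereo p" if "q \<in> S3" "snd (fst q) \<noteq> 0" for q
  proof -
    have "snd q \<noteq> 1"
    proof
      assume "snd q = 1"
      with that have "norm (fst q) = 0"
        by (cases q) (simp add: S3_def norm_Pair)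
      then show False using that by simp
    qed
    then show ?thesis using stereo_unstereo[OF that(1)] by metis
  qed
  have "q \<in> above \<longleftrightarrow> q \<in> stereo ` {p. snd p > 0}" for q
    using ex[of q] sgn(1) stereo_in_S3 unfolding above_def by (smt (verit) imageE imageI mem_Collect_eq)
  then show "above = stereo ` {p. snd p > 0}" by blast
  have "q \<in> below \<longleftrightarrow> q \<in> stereo ` {p. snd p < 0}" for q
    using ex[of q] sgn(2) stereo_in_S3 unfolding below_def by (smt (verit) imageE imageI mem_Collect_eq)
  then show "below = stereo ` {p. snd p < 0}" by blast
qed

lemma above_below_disjoint: "above \<inter> below = {}"
  by (auto simp: above_def below_def)

lemma homeomorphism_stereo: "homeomorphism A (stereo ` A) stereo unstereo"
  using snd_stereo_neq_1
  by (intro homeomorphismI continuous_intros continuous_on_subset[OF continuous_on_unstereo]) auto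

lemma path_connected_above: "path_connected above"
proof -
  have "({p. snd p > 0} :: space3 set) = UNIV \<times> {0<..}"
    by (simp add: set_eq_iff mem_Times_iff)
  moreover have "convex ((UNIV :: complex set) \<times> {0<..} :: space3 set)"
    by (rule convex_Times[OF convex_UNIV]) (rule convex_real_interval)
  ultimately have "convex ({p. snd p > 0} :: space3 set)"
    by metis
  then show ?thesis unfolding above_eq
    by (intro path_connected_continuous_image convex_imp_path_connected continuous_intros)
qed

lemma path_connected_below: "path_connected below"
proof -
  have "({p. snd p < 0} :: space3 set) = UNIV \<times> {..<0}"
    by (simp add: set_eq_iff mem_Times_iff)
  moreover have "convex ((UNIV :: complex set) \<times> {..<0} :: space3 set)"
    by (rule convex_Times[OF convex_UNIV]) (rule convex_real_interval)
  ultimately have "convex ({p. snd p < 0} :: space3 set)"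
    by metis
  then show ?thesis unfolding below_eq
    by (intro path_connected_continuous_image convex_imp_path_connected continuous_intros)
qed

text \<open>
  The points that can be reached when the plane may be crossed in \<open>R\<close> only; the point at infinity is left out.
\<close>

definition crossing_space :: "complex set \<Rightarrow> space4 set" where
  "crossing_space R = stereo ` {p. fst p \<in> R \<or> snd p \<noteq> 0}"

lemma above_subset_crossing: "above \<subseteq> crossing_space R"
  and below_subset_crossing: "below \<subseteq> crossing_space R"
  by (auto simp: above_eq below_eq crossing_space_def)

lemma spine_eq: "spine G = stereo ` (graph_set G \<times> {0})"
  by (auto simp: spine_def plane_def)

lemma crossing_space_avoids_spine:
  assumes "R \<inter> graph_set G = {}"
  shows "crossing_space R \<subseteq> S3 - spine G"
  using assms stereo_in_S3 by (auto simp: crossing_space_def spine_eq inj_eq[OF inj_stereo])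

text \<open>
  For \<open>s > 0\<close> this is the part of a crossing space around the upper half-space, for \<open>s < 0\<close> around
  the lower one.  Moving all points vertically towards height \<open>s\<close> stays inside the set and ends in a
  plane.
\<close>

lemma simply_connected_half:
  fixes R :: "complex set" and s :: real
  assumes "s \<noteq> 0"
  shows "simply_connected {p. fst p \<in> R \<or> s * snd p > 0}" (is "simply_connected ?U")
proof -
  have lift: "homotopic_with_canon (\<lambda>x. True) ?U ?U id (\<lambda>p. (fst p, s))"
  proof (intro homotopic_with_linear continuous_intros subsetI)
    fix p q assume p: "p \<in> ?U" and "q \<in> closed_segment (id p) (fst p, s)"
    then obtain u where u: "0 \<le> u" "u \<le> 1" "q = (1 - u) *\<^sub>R p + u *\<^sub>R (fst p, s)"
      by (auto simp: in_segment)
    have fq: "fst q = fst p" by (simp add: u scaleR_add_left[symmetric])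
    have sq: "s * snd q = (1 - u) * (s * snd p) + u * (s * s)" by (simp add: u algebra_simps)
    have "s * s > 0" using assms by (metis not_real_square_gt_zero)
    have "s * snd q > 0" if "s * snd p > 0"
    proof (cases "u = 0")
      case True
      then show ?thesis using that unfolding sq by simp
    next
      case False
      then have "u > 0" using u by simp
      then have "u * (s * s) > 0" using \<open>s * s > 0\<close> by (rule mult_pos_pos)
      moreover have "(1 - u) * (s * snd p) \<ge> 0" using u(2) less_imp_le[OF that]
        by (intro mult_nonneg_nonneg[of "1 - u"]) simp_all
      ultimately show ?thesis unfolding sq by linarith
    qed
    then show "q \<in> ?U" using p fq by auto
  qed
  have "homotopic_with_canon (\<lambda>x. True) ?U ?U (\<lambda>p. (fst p, s)) (\<lambda>p. (0, s))"
  proof (intro homotopic_with_linear continuous_intros subsetI)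
    fix p q assume p: "p \<in> ?U" and "q \<in> closed_segment (fst p, s) (0, s)"
    then have "snd q = s" by (auto simp: in_segment algebra_simps)
    moreover have "s * s > 0" using assms by (metis not_real_square_gt_zero)
    ultimately show "q \<in> ?U" by auto
  qed
  then have "contractible ?U"
    unfolding contractible_def using lift homotopic_with_trans by blast
  then show ?thesis by (rule contractible_imp_simply_connected)
qed

text \<open>
  The upper and the lower half overlap in the vertical cylinder over \<open>R\<close>, which is connected.
\<close>

lemma simply_connected_crossing_space:
  assumes R: "open R" "connected R" "R \<noteq> {}"
  shows "simply_connected (crossing_space R)"
proof -
  let ?U = "{p::space3. fst p \<in> R \<or> 1 * snd p > 0}" and ?V = "{p::space3. fst p \<in> R \<or> -1 * snd p > 0}"
  have o: "open {p::space3. fst p \<in> R}"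
    using R(1) by (simp add: open_vimage_fst flip: vimage_def)
  have oU: "open ?U" and oV: "open ?V"
    by (auto intro!: open_Collect_disj open_Collect_less continuous_intros o)
  have int: "?U \<inter> ?V = R \<times> UNIV" by (auto)
  have "simply_connected (?U \<union> ?V)"
  proof (rule simply_connected_Un)
    show "path_connected (?U \<inter> ?V)"
      unfolding int using R by (intro path_connected_Times connected_open_path_connected path_connected_UNIV)
    show "?U \<inter> ?V \<noteq> {}" unfolding int using R by auto
  qed (use oU oV simply_connected_half[of 1 R] simply_connected_half[of "-1" R] in \<open>auto intro: open_subset\<close>)
  also have "?U \<union> ?V = {p. fst p \<in> R \<or> snd p \<noteq> 0}" by auto
  finally show ?thesis
    unfolding crossing_space_def
    using homeomorphic_simply_connected_eq[of "{p. fst p \<in> R \<or> snd p \<noteq> 0}"] homeomorphism_stereo homeomorphic_def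
    by blast
qed

section \<open>Region classes and words\<close>

lemma path_class_eqI: "homotopic_paths X p q \<Longrightarrow> path_class X p = path_class X q"
  unfolding path_class_def using homotopic_paths_sym homotopic_paths_trans by blast

lemma loops_at_eq: "p \<in> loops_at X y \<longleftrightarrow> path_between X y y p"
  by (auto simp: loops_at_def path_between_def)

lemma pi1_one: "\<one>\<^bsub>pi1 X y\<^esub> = path_class X (linepath y y)"
  by (simp add: pi1_def linepath_refl)

lemma pi1_carrierI: "path_between X y y p \<Longrightarrow> path_class X p \<in> carrier (pi1 X y)"
  by (simp add: pi1_def loops_at_eq)

lemma pi1_map_path_class:
  assumes p: "path_between A a b p" and f: "continuous_on A f" "f ` A \<subseteq> B"
  shows "pi1_map B f (path_class A p) = path_class B (f \<circ> p)"
proof -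
  have "homotopic_paths B (f \<circ> p) (f \<circ> p')" if "homotopic_paths A p p'" for p'
    using homotopic_paths_continuous_image[OF that f(1)] f(2) by blast
  moreover have "homotopic_paths A p p" using p by (simp add: path_between_def)
  ultimately show ?thesis
    unfolding pi1_map_def path_class_def using homotopic_paths_trans homotopic_paths_sym
    by (metis (no_types, lifting) mem_Collect_eq)
qed

lemma pi1_inverse:
  fixes X :: "'a::real_normed_vector set"
  assumes p: "path_between X y y p"
  shows "inv\<^bsub>pi1 X y\<^esub> (path_class X p) = path_class X (reversepath p)"
proof -
  have "y \<in> X" using path_betweenD(5)[OF p] .
  then interpret group "pi1 X y" by (rule group_pi1)
  have "path_class X (reversepath p) \<otimes>\<^bsub>pi1 X y\<^esub> path_class X p = path_class X (reversepath p +++ p)"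
    using p path_between_reverse[OF p] by (simp only: pi1_mult_path_class loops_at_eq)
  also have "\<dots> = \<one>\<^bsub>pi1 X y\<^esub>"
    unfolding pi1_one using homotopic_paths_linv[of p X] p by (intro path_class_eqI) (auto simp: path_between_def)
  finally show ?thesis
    using p by (intro inv_equality pi1_carrierI) auto
qed

definition region_of :: "complex set \<Rightarrow> complex set \<Rightarrow> bool" where
  "region_of \<Gamma> R \<longleftrightarrow> open R \<and> connected R \<and> R \<noteq> {} \<and> R \<inter> \<Gamma> = {}"

lemma region_of_outside:
  assumes "compact \<Gamma>"
  shows "region_of \<Gamma> (outside \<Gamma>)"
proof -
  have "outside \<Gamma> \<noteq> {}" using unbounded_outside[OF compact_imp_bounded[OF assms]] by auto
  then show ?thesis
    using assms compact_imp_bounded compact_imp_closed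
    by (auto simp: region_of_def intro!: open_outside connected_outside)
qed

lemma region_of_component:
  assumes "compact \<Gamma>" "a \<notin> \<Gamma>"
  shows "region_of \<Gamma> (connected_component_set (- \<Gamma>) a)"
proof -
  have "a \<in> connected_component_set (- \<Gamma>) a" using assms by simp
  then show ?thesis
    using assms connected_component_subset[of "- \<Gamma>" a] open_connected_component[of "- \<Gamma>" a]
    unfolding region_of_def by (metis Int_commute compact_imp_closed connected_connected_component
        disjoint_eq_subset_Compl empty_iff open_Compl)
qed

lemma unbounded_component_eq_outside:
  fixes \<Gamma> :: "complex set"
  assumes "compact \<Gamma>" "\<not> bounded (connected_component_set (- \<Gamma>) a)"
  shows "connected_component_set (- \<Gamma>) a = outside \<Gamma>"
proof -
  have b: "bounded (- (- \<Gamma>))" using assms compact_imp_bounded by simp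
  have dim: "2 \<le> DIM(complex)" by simp
  have "x \<in> outside \<Gamma> \<longleftrightarrow> x \<in> connected_component_set (- \<Gamma>) a" for x
  proof
    assume "x \<in> outside \<Gamma>"
    then have x: "\<not> bounded (connected_component_set (- \<Gamma>) x)" "x \<in> - \<Gamma>"
      by (auto simp: outside_def)
    have "connected_component_set (- \<Gamma>) x = connected_component_set (- \<Gamma>) a"
      by (rule cobounded_unique_unbounded_component[OF b dim]) (use x assms in auto)
    then show "x \<in> connected_component_set (- \<Gamma>) a" using x by (metis connected_component_refl mem_Collect_eq)
  next
    assume "x \<in> connected_component_set (- \<Gamma>) a"
    then show "x \<in> outside \<Gamma>"
      using assms by (metis connected_component_eq mem_Collect_eq outside)
  qed
  then show ?thesis by blast
qed

lemma crossing_space_subset: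
  "region_of (graph_set G) R \<Longrightarrow> crossing_space R \<subseteq> S3 - spine G"
  by (intro crossing_space_avoids_spine) (simp add: region_of_def)

lemma crossing_space_homotopic:
  assumes R: "region_of (graph_set G) R"
    and "path_between (crossing_space R) a b p" "path_between (crossing_space R) a b q"
  shows "homotopic_paths (S3 - spine G) p q"
  using R assms(2,3)
  by (intro simply_connected_homotopic[OF simply_connected_crossing_space crossing_space_subset[OF R]])
    (auto simp: region_of_def)

lemma crossing_space_path:
  assumes R: "region_of (graph_set G) R" and "a \<in> crossing_space R" "b \<in> crossing_space R"
  obtains p where "path_between (crossing_space R) a b p"
proof (rule path_connected_between[of _ a b])
  show "path_connected (crossing_space R)"
    using R by (intro simply_connected_imp_path_connected simply_connected_crossing_space) (auto simp: region_of_def)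
qed (use assms in auto)

lemma handle_core_between:
  assumes "a \<in> R"
  shows "path_between (crossing_space R) (stereo (a, 1)) (stereo (a, -1)) (handle_core a)"
proof -
  have "fst p \<in> R" if "p \<in> closed_segment (a, 1) (a, - 1::real)" for p
    using that assms by (auto simp: in_segment algebra_simps simp flip: scaleR_add_left)
  then have "closed_segment (a, 1) (a, - 1 :: real) \<subseteq> {p. fst p \<in> R \<or> snd p \<noteq> 0}"
    by (intro subsetI CollectI disjI1)
  then have "path_between {p :: space3. fst p \<in> R \<or> snd p \<noteq> 0} (a, 1) (a, - 1) (linepath (a, 1) (a, - 1))"
    by (simp add: path_between_def)
  then show ?thesis
    unfolding handle_core_def crossing_space_def
    by (rule path_between_image) (auto intro!: continuous_intros)
qed

text \<open>
  A region loop is cut at its second vertical segment.  The part before runs in the crossing space of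
  the region and the part after in that of the unbounded region, so each may be replaced by
  a path through \<open>c\<close>.  It follows that all region loops are homotopic; that some region loop exists
  is needed too, since otherwise the class would be empty.
\<close>

lemma region_class_eq:
  assumes G: "compact (graph_set G)" and R: "region_of (graph_set G) R"
    and y: "y \<in> above" and c: "c \<in> below"
    and A: "path_between (crossing_space R) y c A"
    and B: "path_between (crossing_space (outside (graph_set G))) y c B"
  shows "region_class G y R = path_class (S3 - spine G) (A +++ reversepath B)"
proof -
  note [trans] = homotopic_paths_trans
  let ?X = "S3 - spine G" and ?out = "outside (graph_set G)"
  note RO = region_of_outside[OF G]
  note sub = path_between_mono[OF _ crossing_space_subset[OF R]] path_between_mono[OF _ crossing_space_subset[OF RO]]
  note ab = path_between_mono[OF _ above_subset_crossing] path_between_mono[OF _ below_subset_crossing]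
  have loop: "homotopic_paths ?X g (A +++ reversepath B)" if rl: "region_loop G y R g" for g
  proof -
    obtain a b h1 h2 h3 where a: "a \<in> R" and b: "b \<in> ?out"
      and h1: "path_between above y (stereo (a, 1)) h1"
      and h2: "path_between below (stereo (a, -1)) (stereo (b, -1)) h2"
      and h3: "path_between above (stereo (b, 1)) y h3"
      and g: "g = h1 +++ handle_core a +++ h2 +++ reversepath (handle_core b) +++ h3"
      using rl unfolding region_loop_def path_between_def by blast
    have "stereo (b, -1) \<in> below" by (simp add: below_eq)
    then obtain z where z: "path_between below c (stereo (b, -1)) z"
      using path_connected_between[OF path_connected_below c] by blast
    have ka: "path_between (crossing_space R) (stereo (a, 1)) (stereo (a, -1)) (handle_core a)"
      and kb: "path_between (crossing_space ?out) (stereo (b, 1)) (stereo (b, -1)) (handle_core b)"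
      using a b handle_core_between by auto
    let ?s = "reversepath (handle_core b) +++ h3"
    have s: "path_between (crossing_space ?out) (stereo (b, -1)) y ?s"
      using kb ab(1)[OF h3] by blast
    have r: "path_between (crossing_space R) y (stereo (b, -1)) (h1 +++ (handle_core a +++ h2))"
      using ab(1)[OF h1] ka ab(2)[OF h2] by blast
    have h1X: "path_between ?X y (stereo (a, 1)) h1" and kaX: "path_between ?X (stereo (a, 1)) (stereo (a, -1)) (handle_core a)"
      and h2X: "path_between ?X (stereo (a, -1)) (stereo (b, -1)) h2" and sX: "path_between ?X (stereo (b, -1)) y ?s"
      and zX: "path_between ?X c (stereo (b, -1)) z" and AX: "path_between ?X y c A"
      and OX: "path_between ?X y c B"
      using sub(1)[OF ab(1)[OF h1]] sub(1)[OF ka] sub(1)[OF ab(2)[OF h2]] sub(2)[OF s]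
        sub(1)[OF ab(2)[OF z]] sub(1)[OF A] sub(2)[OF B] by auto
    have "homotopic_paths ?X g (h1 +++ ((handle_core a +++ h2) +++ ?s))"
      unfolding g using h1X kaX h2X sX
      by (intro homotopic_join_right[OF homotopic_paths_sym[OF homotopic_assoc]]) blast+
    also have "homotopic_paths ?X \<dots> ((h1 +++ (handle_core a +++ h2)) +++ ?s)"
      using h1X kaX h2X sX by (intro homotopic_paths_sym[OF homotopic_assoc]) blast+
    also have "homotopic_paths ?X \<dots> ((A +++ z) +++ (reversepath z +++ reversepath B))"
    proof (rule homotopic_join)
      show "homotopic_paths ?X (h1 +++ (handle_core a +++ h2)) (A +++ z)"
        by (rule crossing_space_homotopic[OF R r]) (use A ab(2)[OF z] in blast)
      show "homotopic_paths ?X ?s (reversepath z +++ reversepath B)"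
        by (rule crossing_space_homotopic[OF RO s]) (use B ab(2)[OF z] in blast)
      show "path_between ?X y (stereo (b, -1)) (h1 +++ (handle_core a +++ h2))"
        using h1X kaX h2X by blast
    qed (rule sX)
    also have "homotopic_paths ?X \<dots> (A +++ (z +++ (reversepath z +++ reversepath B)))"
      using AX zX OX by (intro homotopic_assoc) blast+
    also have "homotopic_paths ?X \<dots> (A +++ reversepath B)"
      using AX zX OX by (intro homotopic_join_right[OF homotopic_cancel]) blast+
    finally show ?thesis .
  qed
  have "\<exists>g. region_loop G y R g"
  proof -
    obtain a b where a: "a \<in> R" and b: "b \<in> ?out" using R RO unfolding region_of_def by blast
    have pts: "stereo (a, 1) \<in> above" "stereo (b, 1) \<in> above" "stereo (a, -1) \<in> below" "stereo (b, -1) \<in> below"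
      by (auto simp: above_eq below_eq)
    obtain h1 where "path_between above y (stereo (a, 1)) h1"
      using path_connected_between[OF path_connected_above y pts(1)] .
    moreover obtain h2 where "path_between below (stereo (a, -1)) (stereo (b, -1)) h2"
      using path_connected_between[OF path_connected_below pts(3,4)] .
    moreover obtain h3 where "path_between above (stereo (b, 1)) y h3"
      using path_connected_between[OF path_connected_above pts(2) y] .
    ultimately show ?thesis using a b unfolding region_loop_def path_between_def by blast
  qed
  then show ?thesis
    unfolding region_class_def path_class_def
    using loop homotopic_paths_sym homotopic_paths_trans by blast
qed

text \<open>
  One descent through \<open>R\<close>, from \<open>u\<close> above to \<open>v\<close> below, where \<open>s\<close> and \<open>t\<close> join the base point to \<open>u\<close>
  and \<open>v\<close> through the unbounded region.  The loop \<open>L\<close> that measures the descent has the class of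
  the letter \<open>R\<close>: replace \<open>s\<close> by a path above the plane, and insert at \<open>c\<close> the way back to
  \<open>y\<close> through the unbounded region and down again.  For unbounded \<open>R\<close> everything happens in one simply
  connected set and \<open>L\<close> is constant.
\<close>

lemma descending_step:
  assumes G: "compact (graph_set G)" and R: "R = connected_component_set (- graph_set G) a" "a \<notin> graph_set G"
    and y: "y \<in> above" and u: "u \<in> above" and v: "v \<in> below"
    and s: "path_between (crossing_space (outside (graph_set G))) y u s"
    and t: "path_between (crossing_space (outside (graph_set G))) y v t"
    and q: "path_between (crossing_space R) u v q"
  obtains L where "path_between (S3 - spine G) y y L"
    and "homotopic_paths (S3 - spine G) (s +++ q) (L +++ t)"
    and "\<And>ls. word_value G y ls \<in> carrier (pi1 (S3 - spine G) y) \<Longrightarrow>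
      word_value G y ((if bounded R then [(R, True)] else []) @ ls) =
      path_class (S3 - spine G) L \<otimes>\<^bsub>pi1 (S3 - spine G) y\<^esub> word_value G y ls"
    and "\<And>ls. word_value G y ls \<in> carrier (pi1 (S3 - spine G) y) \<Longrightarrow>
      word_value G y ((if bounded R then [(R, False)] else []) @ ls) =
      path_class (S3 - spine G) (reversepath L) \<otimes>\<^bsub>pi1 (S3 - spine G) y\<^esub> word_value G y ls"
proof -
  note [trans] = homotopic_paths_trans
  let ?X = "S3 - spine G" and ?out = "outside (graph_set G)"
  note RO = region_of_outside[OF G]
  have RR: "region_of (graph_set G) R" using R region_of_component[OF G] by simp
  note sub = path_between_mono[OF _ crossing_space_subset[OF RR]] path_between_mono[OF _ crossing_space_subset[OF RO]]
  note ab = path_between_mono[OF _ above_subset_crossing] path_between_mono[OF _ below_subset_crossing]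
  have yX: "y \<in> ?X" using path_betweenD(5)[OF sub(2)[OF s]] .
  interpret H: group "pi1 ?X y" using yX by (rule group_pi1)
  show ?thesis
  proof (cases "bounded R")
    case False
    then have RO': "R = ?out" using R unbounded_component_eq_outside[OF G] by metis
    have "homotopic_paths ?X (s +++ q) t"
      by (rule crossing_space_homotopic[OF RO]) (use s t q RO' in blast)+
    also have "homotopic_paths ?X t (linepath y y +++ t)"
      using sub(2)[OF t] by (intro homotopic_paths_sym[OF homotopic_paths_lid']) (auto simp: path_between_def)
    finally have "homotopic_paths ?X (s +++ q) (linepath y y +++ t)" .
    then show ?thesis
      using False path_between_refl[OF yX] by (intro that[of "linepath y y"]) (simp_all add: pi1_one[symmetric])
  next
    case True
    define c :: space4 where "c = stereo (0, -1)"
    have c: "c \<in> below" by (simp add: c_def below_eq)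
    have "y \<in> crossing_space R" "c \<in> crossing_space R" "y \<in> crossing_space ?out" "c \<in> crossing_space ?out"
      using y c above_subset_crossing below_subset_crossing by auto
    then obtain A B where A: "path_between (crossing_space R) y c A" and B: "path_between (crossing_space ?out) y c B"
      using crossing_space_path[OF RR, of y c] crossing_space_path[OF RO, of y c] by metis
    obtain h where h: "path_between above y u h" using path_connected_between[OF path_connected_above y u] .
    obtain z where z: "path_between below c v z" using path_connected_between[OF path_connected_below c v] .
    have sX: "path_between ?X y u s" and tX: "path_between ?X y v t" and qX: "path_between ?X u v q"
      and AX: "path_between ?X y c A" and OX: "path_between ?X y c B" and zX: "path_between ?X c v z"
      and hX: "path_between ?X y u h"
      using sub(2)[OF s] sub(2)[OF t] sub(1)[OF q] sub(1)[OF A] sub(2)[OF B] sub(1)[OF ab(2)[OF z]] sub(1)[OF ab(1)[OF h]] by auto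
    let ?L = "A +++ reversepath B"
    have L: "path_between ?X y y ?L" using AX OX by blast
    have cls: "region_class G y R = path_class ?X ?L"
      by (rule region_class_eq[OF G RR y c A B])
    have "homotopic_paths ?X (s +++ q) (h +++ q)"
      using crossing_space_homotopic[OF RO s ab(1)[OF h]] sX qX by (rule homotopic_join_left)
    also have "homotopic_paths ?X \<dots> (A +++ z)"
      by (rule crossing_space_homotopic[OF RR]) (use A q ab(1)[OF h] ab(2)[OF z] in blast)+
    also have "homotopic_paths ?X \<dots> (A +++ (reversepath B +++ (B +++ z)))"
      using AX OX zX by (intro homotopic_join_right[OF homotopic_paths_sym[OF homotopic_cancel']]) blast+
    also have "homotopic_paths ?X \<dots> (?L +++ (B +++ z))"
      using AX OX zX by (intro homotopic_paths_sym[OF homotopic_assoc]) blast+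
    also have "homotopic_paths ?X \<dots> (?L +++ t)"
    proof (rule homotopic_join_right)
      show "homotopic_paths ?X (B +++ z) t"
        by (rule crossing_space_homotopic[OF RO]) (use B t ab(2)[OF z] in blast)+
      show "path_between ?X y y ?L" "path_between ?X y v (B +++ z)" using L OX zX by blast+
    qed
    finally have "homotopic_paths ?X (s +++ q) (?L +++ t)" .
    then show ?thesis
      using True L pi1_inverse[OF L] by (intro that[of ?L]) (simp_all add: word_value_def Let_def cls)
  qed
qed

text \<open>
  Walking an edge backwards replaces the loop that measures it by its reverse.
\<close>

lemma homotopic_transpose:
  fixes X :: "'a::real_normed_vector set"
  assumes s: "path_between X y u s" and t: "path_between X y v t" and p: "path_between X u v p"
    and L: "path_between X y y L" and hom: "homotopic_paths X (s +++ p) (L +++ t)"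
  shows "homotopic_paths X (t +++ reversepath p) (reversepath L +++ s)"
proof -
  note [trans] = homotopic_paths_trans
  have "homotopic_paths X (t +++ reversepath p) ((reversepath L +++ (L +++ t)) +++ reversepath p)"
    using s t p L by (intro homotopic_join_left[OF homotopic_paths_sym[OF homotopic_cancel']]) blast+
  also have "homotopic_paths X \<dots> ((reversepath L +++ (s +++ p)) +++ reversepath p)"
    using s t p L
    by (intro homotopic_join_left[OF homotopic_join_right[OF homotopic_paths_sym[OF hom]]]) blast+
  also have "homotopic_paths X \<dots> (reversepath L +++ ((s +++ p) +++ reversepath p))"
    using s t p L by (intro homotopic_assoc) blast+
  also have "homotopic_paths X \<dots> (reversepath L +++ s)"
  proof (rule homotopic_join_right)
    have "homotopic_paths X ((s +++ p) +++ reversepath p) (s +++ (p +++ reversepath p))"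
      using s p by (intro homotopic_assoc) blast+
    also have "homotopic_paths X \<dots> (s +++ linepath u u)"
      using s p homotopic_paths_rinv[of p X]
      by (intro homotopic_join_right) (auto simp: path_between_def path_image_join)
    also have "homotopic_paths X \<dots> s"
      using s by (intro homotopic_paths_rid') (auto simp: path_between_def)
    finally show "homotopic_paths X ((s +++ p) +++ reversepath p) s" .
  qed (use s p L in blast)+
  finally show ?thesis .
qed

section \<open>The push-off of an edge\<close>

text \<open>
  The angle \<open>\<theta>\<close> of the band, continued by \<open>0\<close> and \<open>\<pi>\<close> over the two disks.
\<close>

definition tilt :: "real \<Rightarrow> real" where
  "tilt t = pi * (3 * max (1/3) (min (2/3) t) - 1)"

lemma tilt_simps:
  "t \<le> 1/3 \<Longrightarrow> tilt t = 0" "t \<ge> 2/3 \<Longrightarrow> tilt t = pi"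
  "1/3 \<le> t \<Longrightarrow> t \<le> 2/3 \<Longrightarrow> tilt t = pi * (3 * t - 1)"
  by (auto simp: tilt_def max_def min_def)

lemma sin_tilt_nonneg: "sin (tilt t) \<ge> 0"
proof (rule sin_ge_zero)
  have "0 \<le> 3 * max (1/3) (min (2/3) t) - 1" "3 * max (1/3) (min (2/3) t) - 1 \<le> 1" by auto
  then show "0 \<le> tilt t" "tilt t \<le> pi"
    unfolding tilt_def using pi_gt_zero by (auto intro: mult_left_le)
qed

lemma band_height_cases: "band_height r = 1 \<or> band_height r = -1"
  by (cases r) (auto simp: band_height_def)

locale ribbon_edge =
  fixes G :: "'e state_surface" and e :: 'e
  assumes ribbon: "state_ribbon G" and edge: "e \<in> edges G"
begin

definition "tail \<equiv> pathstart (curve G e)"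
definition "head \<equiv> pathfinish (curve G e)"

text \<open>
  The component of \<open>(Im (fst p), snd p)\<close> along the normal of the tilted cross-section; the normal
  points up over the disk at the tail and down over the disk at the head.  The surface is the zero set.
\<close>

definition side_height :: "space3 \<Rightarrow> real" where
  "side_height p = snd p * cos (tilt (Re (fst p))) - band_height (res G e) * Im (fst p) * sin (tilt (Re (fst p)))"

definition tube :: "space3 set" where
  "tube = {p. 0 < Re (fst p) \<and> Re (fst p) < 1 \<and> (Im (fst p))\<^sup>2 + (snd p)\<^sup>2 < 1}"

definition thicken :: "space3 \<Rightarrow> space3" where
  "thicken p = (strip G e (fst p), snd p)"

text \<open>
  Near the edge, \<open>side 1\<close> is the side of the surface that faces above at the tail, and \<open>side (-1)\<close>
  is the opposite one.  The interiors of the disks are added because the strip is not a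
  neighbourhood of the ends of the edge.
\<close>

definition side :: "real \<Rightarrow> space3 set" where
  "side \<sigma> = interior (disk G tail) \<times> {z. \<sigma> * z > 0} \<union> thicken ` {p \<in> tube. \<sigma> * side_height p > 0} \<union>
            interior (disk G head) \<times> {z. \<sigma> * z < 0}"

definition neighbourhood :: "space3 set" where
  "neighbourhood = interior (disk G tail) \<times> UNIV \<union> thicken ` tube \<union> interior (disk G head) \<times> UNIV"

text \<open>
  For \<open>\<kappa> = 1\<close> the region to the left of the edge, for \<open>\<kappa> = -1\<close> the one to the right.
\<close>

definition side_region :: "real \<Rightarrow> complex set" where
  "side_region \<kappa> = connected_component_set (- graph_set G) (strip G e (Complex (1/2) (\<kappa> / 2)))"

lemma pg: "plane_graph G"
  using ribbon by (simp add: state_ribbon_def)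

lemma ends: "tail \<in> verts G" "head \<in> verts G" "arc (curve G e)" "tail \<noteq> head"
proof -
  show "tail \<in> verts G" "head \<in> verts G" and arc: "arc (curve G e)"
    using pg edge by (simp_all add: plane_graph_def tail_def head_def)
  show "tail \<noteq> head" using arc_distinct_ends[OF arc] by (simp add: tail_def head_def)
qed

lemma disks: 
  "w \<in> verts G \<Longrightarrow> w \<in> interior (disk G w)" 
  "w \<in> verts G \<Longrightarrow> w' \<in> verts G \<Longrightarrow> w \<noteq> w' \<Longrightarrow> disk G w \<inter> disk G w' = {}"
  using ribbon by (simp_all add: state_ribbon_def)

lemma strip_props:
  assumes "d \<in> edges G"
  shows "continuous_on strip_dom (strip G d)" "inj_on (strip G d) strip_dom"
    "\<And>t. t \<in> {0..1} \<Longrightarrow> strip G d (Complex t 0) = curve G d t"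
    "\<And>z w. z \<in> strip_dom \<Longrightarrow> w \<in> verts G \<Longrightarrow> strip G d z \<in> disk G w \<longleftrightarrow>
       w = pathstart (curve G d) \<and> Re z \<le> 1/3 \<or> w = pathfinish (curve G d) \<and> Re z \<ge> 2/3"
  using ribbon assms by (simp_all add: state_ribbon_def)

lemma strip_bands_disjoint:
  "d \<in> edges G \<Longrightarrow> d \<noteq> e \<Longrightarrow> z \<in> band_dom \<Longrightarrow> z' \<in> band_dom \<Longrightarrow> strip G e z \<noteq> strip G d z'"
proof -
  assume d: "d \<in> edges G" "d \<noteq> e" "z \<in> band_dom" "z' \<in> band_dom"
  then have "strip G e ` band_dom \<inter> strip G d ` band_dom = {}"
    using ribbon edge by (simp add: state_ribbon_def)
  then show ?thesis using d(3,4) by blast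
qed

lemma strip_dom_iff: "z \<in> strip_dom \<longleftrightarrow> 0 \<le> Re z \<and> Re z \<le> 1 \<and> -1 \<le> Im z \<and> Im z \<le> 1"
  by (auto simp: strip_dom_def in_cbox_complex_iff)

lemma band_dom_iff: "z \<in> band_dom \<longleftrightarrow> 1/3 \<le> Re z \<and> Re z \<le> 2/3 \<and> -1 \<le> Im z \<and> Im z \<le> 1"
  by (auto simp: band_dom_def in_cbox_complex_iff)

lemma strip_in_disk:
  assumes "z \<in> strip_dom"
  shows "strip G e z \<in> disk G tail \<longleftrightarrow> Re z \<le> 1/3" "strip G e z \<in> disk G head \<longleftrightarrow> Re z \<ge> 2/3"
  using strip_props(4)[OF edge assms] ends unfolding tail_def head_def by auto

lemma tube_strip_dom: "p \<in> tube \<Longrightarrow> fst p \<in> strip_dom"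
proof -
  assume p: "p \<in> tube"
  then have "(Im (fst p))\<^sup>2 < 1" by (simp add: tube_def) (smt (verit) zero_le_power2)
  then have "\<bar>Im (fst p)\<bar> < 1" by (simp add: abs_square_less_1)
  then show ?thesis using p by (auto simp: tube_def strip_dom_iff)
qed

lemma inj_thicken: "inj_on thicken tube"
  using strip_props(2)[OF edge] tube_strip_dom
  by (auto simp: thicken_def inj_on_def prod_eq_iff)

lemma continuous_thicken: "continuous_on tube thicken"
  unfolding thicken_def using tube_strip_dom
  by (intro continuous_on_Pair continuous_on_compose2[OF strip_props(1)[OF edge]] continuous_intros) auto

lemma continuous_side_height: "continuous_on A side_height"
  unfolding side_height_def tilt_def
  by (intro continuous_intros)

lemma open_tube: "open tube"
  unfolding tube_def by (intro open_Collect_conj open_Collect_less continuous_intros)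

text \<open>
  The strip is only known to be injective and continuous, so openness of its image rests on invariance of domain.
\<close>

lemma open_thicken_image: "open U \<Longrightarrow> U \<subseteq> tube \<Longrightarrow> open (thicken ` U)"
  using continuous_on_subset[OF continuous_thicken] inj_on_subset[OF inj_thicken]
  by (intro invariance_of_domain) auto

lemma open_side: "open (side \<sigma>)"
proof -
  have "{p \<in> tube. \<sigma> * side_height p > 0} = tube \<inter> {p. 0 < \<sigma> * side_height p}" by blast
  moreover have "open (tube \<inter> {p. 0 < \<sigma> * side_height p})"
    by (intro open_Int open_tube open_Collect_less continuous_intros continuous_side_height)
  ultimately have "open (thicken ` {p \<in> tube. \<sigma> * side_height p > 0})"
    by (intro open_thicken_image) auto
  then show ?thesis unfolding side_def
    by (intro open_Un open_Times open_interior open_Collect_less continuous_intros)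
qed

lemma open_neighbourhood: "open neighbourhood"
  unfolding neighbourhood_def
  by (intro open_Un open_Times open_interior open_UNIV open_thicken_image open_tube order_refl)

lemma side_height_tail: "Re (fst p) \<le> 1/3 \<Longrightarrow> side_height p = snd p"
  and side_height_head: "Re (fst p) \<ge> 2/3 \<Longrightarrow> side_height p = - snd p"
  by (simp_all add: side_height_def tilt_simps)

lemma side_cases:
  assumes "p \<in> side \<sigma>"
  obtains (tail) "fst p \<in> disk G tail" "\<sigma> * snd p > 0"
    | (tube) q where "q \<in> tube" "\<sigma> * side_height q > 0" "p = thicken q"
    | (head) "fst p \<in> disk G head" "\<sigma> * snd p < 0"
  using assms subsetD[OF interior_subset, of "fst p" "disk G tail"]
    subsetD[OF interior_subset, of "fst p" "disk G head"]
  unfolding side_def by (elim UnE imageE) (auto simp: mem_Times_iff)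

lemma disk_tail_head: "z \<in> disk G tail \<Longrightarrow> z \<notin> disk G head"
  using disks(2)[OF ends(1,2,4)] by blast

lemma side_over_tail:
  assumes "p \<in> side \<sigma>" "fst p \<in> disk G tail"
  shows "\<sigma> * snd p > 0"
  using assms(1)
proof (cases rule: side_cases)
  case (tube q)
  then have "Re (fst q) \<le> 1/3" using assms(2) strip_in_disk(1)[OF tube_strip_dom] by (simp add: thicken_def)
  then show ?thesis using tube side_height_tail[of q] by (simp add: thicken_def)
qed (use assms disk_tail_head in auto)

lemma side_over_head:
  assumes "p \<in> side \<sigma>" "fst p \<in> disk G head"
  shows "\<sigma> * snd p < 0"
  using assms(1)
proof (cases rule: side_cases)
  case (tube q)
  then have "Re (fst q) \<ge> 2/3" using assms(2) strip_in_disk(2)[OF tube_strip_dom] by (simp add: thicken_def)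
  then show ?thesis using tube side_height_head[of q] by (simp add: thicken_def)
qed (use assms disk_tail_head in auto)

lemma sides_disjoint: "side 1 \<inter> side (-1) = {}"
proof -
  have False if p: "p \<in> side 1" "p \<in> side (-1)" for p
  proof (cases "fst p \<in> disk G tail \<or> fst p \<in> disk G head")
    case True
    then show False
      using side_over_tail[OF p(1)] side_over_tail[OF p(2)] side_over_head[OF p(1)] side_over_head[OF p(2)] by auto
  next
    case False
    obtain q where "q \<in> tube" "1 * side_height q > 0" "p = thicken q"
      using p(1) by (cases rule: side_cases) (use False in auto)
    moreover obtain q' where "q' \<in> tube" "-1 * side_height q' > 0" "p = thicken q'"
      using p(2) by (cases rule: side_cases) (use False in auto)
    ultimately show False using inj_onD[OF inj_thicken, of q q'] by auto
  qed
  then show ?thesis by blast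
qed

lemma disk_in_surface: "w \<in> verts G \<Longrightarrow> z \<in> disk G w \<Longrightarrow> stereo (z, 0) \<in> surface G"
  unfolding surface_def by blast

text \<open>
  On the band, vanishing of the side height means that \<open>(Im (fst p), snd p)\<close> is a multiple \<open>s\<close> of the
  unit vector along the cross-section; \<open>s\<close> is recovered as the scalar product with it.
\<close>

lemma zero_side_in_surface:
  assumes p: "p \<in> tube" "side_height p = 0"
  shows "stereo (thicken p) \<in> surface G"
proof -
  note dom = tube_strip_dom[OF p(1)]
  let ?t = "Re (fst p)" and ?i = "Im (fst p)" and ?z = "snd p" and ?b = "band_height (res G e)"
  consider "?t \<le> 1/3" | "?t \<ge> 2/3" | "1/3 \<le> ?t" "?t \<le> 2/3" by linarith
  then show ?thesis
  proof cases
    case 1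
    then show ?thesis
      using p dom ends disk_in_surface[of tail] by (simp add: thicken_def side_height_tail strip_in_disk)
  next
    case 2
    then show ?thesis
      using p dom ends disk_in_surface[of head] by (simp add: thicken_def side_height_head strip_in_disk)
  next
    case 3
    define \<theta> where "\<theta> = pi * (3 * ?t - 1)"
    \<comment> \<open>the band parameter of the point\<close>
    define s where "s = ?i * cos \<theta> + ?b * ?z * sin \<theta>"
    have b: "?b * ?b = 1" using band_height_cases[of "res G e"] by auto
    have eq: "?z * cos \<theta> = ?b * ?i * sin \<theta>"
      using p(2) 3 by (simp add: side_height_def tilt_simps \<theta>_def)
    have one: "cos \<theta> * cos \<theta> + sin \<theta> * sin \<theta> = 1" by (metis sin_cos_squared_add3)
    have "s * cos \<theta> = ?i * (cos \<theta> * cos \<theta>) + ?b * (?z * cos \<theta>) * sin \<theta>"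
      by (simp add: s_def algebra_simps)
    also have "\<dots> = ?i * (cos \<theta> * cos \<theta>) + (?b * ?b) * ?i * (sin \<theta> * sin \<theta>)"
      unfolding eq by (simp add: algebra_simps)
    also have "\<dots> = ?i * (cos \<theta> * cos \<theta> + sin \<theta> * sin \<theta>)"
      unfolding b by (simp only: mult_1_left distrib_left)
    finally have si: "s * cos \<theta> = ?i" unfolding one mult_1_right .
    have "?b * s * sin \<theta> = (?b * ?i * sin \<theta>) * cos \<theta> + (?b * ?b) * ?z * (sin \<theta> * sin \<theta>)"
      by (simp add: s_def algebra_simps)
    also have "\<dots> = ?z * (cos \<theta> * cos \<theta> + sin \<theta> * sin \<theta>)"
      unfolding eq[symmetric] b by (simp only: mult_1_left distrib_left mult.assoc)
    finally have sz: "?b * s * sin \<theta> = ?z" unfolding one mult_1_right .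
    have "?i * ?i + ?z * ?z = (s * cos \<theta>) * (s * cos \<theta>) + (?b * s * sin \<theta>) * (?b * s * sin \<theta>)"
      by (simp only: si sz)
    also have "\<dots> = s * s * (cos \<theta> * cos \<theta>) + (?b * ?b) * (s * s) * (sin \<theta> * sin \<theta>)"
      by (simp only: ac_simps)
    also have "\<dots> = s * s * (cos \<theta> * cos \<theta> + sin \<theta> * sin \<theta>)"
      unfolding b by (simp only: mult_1_left distrib_left mult.assoc)
    finally have "s\<^sup>2 < 1" using p(1) unfolding one by (simp add: tube_def power2_eq_square)
    then have "\<bar>s\<bar> < 1" by (simp add: abs_square_less_1)
    then have "-1 \<le> s" "s \<le> 1" by auto
    moreover have "thicken p = (strip G e (Complex ?t (s * cos \<theta>)), ?b * s * sin \<theta>)"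
      by (simp add: thicken_def si sz)
    ultimately have "thicken p \<in> band G e" unfolding band_def using 3 \<theta>_def by blast
    then show ?thesis using edge unfolding surface_def by blast
  qed
qed

lemma neighbourhood_minus_surface:
  assumes "p \<in> neighbourhood" "stereo p \<notin> surface G"
  shows "p \<in> side 1 \<union> side (-1)"
proof -
  have disk: "snd p \<noteq> 0" if "w \<in> verts G" "fst p \<in> disk G w" for w
    using disk_in_surface[OF that] assms(2) by (cases p) auto
  consider "fst p \<in> interior (disk G tail)" | "fst p \<in> interior (disk G head)" | q where "q \<in> tube" "p = thicken q"
    using assms(1) unfolding neighbourhood_def by (cases p) auto
  then show ?thesis
  proof cases
    case 1
    then have "snd p \<noteq> 0" using disk ends interior_subset by blast
    then show ?thesis using 1 by (cases p) (auto simp: side_def)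
  next
    case 2
    then have "snd p \<noteq> 0" using disk ends interior_subset by blast
    then show ?thesis using 2 by (cases p) (auto simp: side_def)
  next
    case 3
    then have "side_height q \<noteq> 0" using zero_side_in_surface[of q] assms(2) by auto
    then have "1 * side_height q > 0 \<or> -1 * side_height q > 0" by auto
    then show ?thesis using 3 unfolding side_def by blast
  qed
qed

text \<open>
  Strips of different edges may overlap inside the disks, so only the middle third of a strip is
  certain to be free of other edges.
\<close>

lemma half_band_avoids_graph:
  assumes z: "1/3 < Re z" "Re z < 2/3" "Im z \<noteq> 0" "-1 \<le> Im z" "Im z \<le> 1"
  shows "strip G e z \<notin> graph_set G"
proof
  have dom: "z \<in> strip_dom" "z \<in> band_dom" using z by (auto simp: strip_dom_iff band_dom_iff)
  have nodisk: "strip G e z \<notin> disk G w" if "w \<in> verts G" for w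
    using strip_props(4)[OF edge dom(1) that] z by auto
  assume "strip G e z \<in> graph_set G"
  then consider "strip G e z \<in> verts G" | d where "d \<in> edges G" "strip G e z \<in> path_image (curve G d)"
    unfolding graph_set_def by blast
  then show False
  proof cases
    case 1
    then show False using nodisk disks(1) interior_subset by blast
  next
    case 2
    then obtain t where t: "t \<in> {0..1}" "strip G e z = strip G d (Complex t 0)"
      using strip_props(3)[OF 2(1)] by (auto simp: path_image_def)
    have tdom: "Complex t 0 \<in> strip_dom" using t by (simp add: strip_dom_iff)
    have dends: "pathstart (curve G d) \<in> verts G" "pathfinish (curve G d) \<in> verts G"
      using pg 2(1) by (auto simp: plane_graph_def)
    show False
    proof (cases "d = e")
      case True
      then have "z = Complex t 0" using t dom tdom inj_onD[OF strip_props(2)[OF edge]] by blast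
      then show False using z by simp
    next
      case False
      have "t \<le> 1/3 \<Longrightarrow> False" "t \<ge> 2/3 \<Longrightarrow> False"
        using strip_props(4)[OF 2(1) tdom] dends nodisk t(2) by auto
      moreover have "1/3 \<le> t \<Longrightarrow> t \<le> 2/3 \<Longrightarrow> False"
        using strip_bands_disjoint[OF 2(1) False dom(2), of "Complex t 0"] t by (simp add: band_dom_iff)
      ultimately show False by linarith
    qed
  qed
qed

lemma half_band_in_region:
  assumes \<kappa>: "\<kappa> = 1 \<or> \<kappa> = -1" and z: "1/3 < Re z" "Re z < 2/3" "0 < \<kappa> * Im z" "\<kappa> * Im z \<le> 1"
  shows "strip G e z \<in> side_region \<kappa>"
proof -
  let ?M = "{z. 1/3 < Re z \<and> Re z < 2/3 \<and> 0 < \<kappa> * Im z \<and> \<kappa> * Im z \<le> 1}"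
  have "?M = {z. inner 1 z > 1/3} \<inter> {z. inner 1 z < 2/3} \<inter> {z. inner (\<kappa> *\<^sub>R \<i>) z > 0} \<inter> {z. inner (\<kappa> *\<^sub>R \<i>) z \<le> 1}"
    by (auto simp: inner_complex_def)
  moreover have "convex \<dots>"
    by (intro convex_Int convex_halfspace_gt convex_halfspace_lt convex_halfspace_le)
  ultimately have "connected ?M" using convex_connected by metis
  moreover have M: "w \<in> strip_dom" "strip G e w \<notin> graph_set G" if "w \<in> ?M" for w
  proof -
    have "-1 \<le> Im w" "Im w \<le> 1" "Im w \<noteq> 0" using that \<kappa> by auto
    then show "w \<in> strip_dom" "strip G e w \<notin> graph_set G"
      using that half_band_avoids_graph[of w] by (auto simp: strip_dom_iff)
  qed
  ultimately have "connected (strip G e ` ?M)"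
    by (intro connected_continuous_image continuous_on_subset[OF strip_props(1)[OF edge]]) auto
  moreover have "strip G e ` ?M \<subseteq> - graph_set G" using M by blast
  moreover have "strip G e (Complex (1/2) (\<kappa> / 2)) \<in> strip G e ` ?M" using \<kappa> by (intro imageI) auto
  ultimately have "strip G e ` ?M \<subseteq> side_region \<kappa>"
    unfolding side_region_def by (intro connected_component_maximal)
  then show ?thesis using z by blast
qed

text \<open>
  At height \<open>0\<close> only the term of the side height with \<open>sin\<close> is left.  It vanishes outside the middle
  third, and there its sign tells the left half of the band from the right half.
\<close>

lemma side_crosses_in_region:
  assumes p: "p \<in> side \<sigma>" "snd p = 0" and \<sigma>: "\<sigma> = 1 \<or> \<sigma> = -1"
  shows "fst p \<in> side_region (- \<sigma> * band_height (res G e))"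
proof -
  let ?b = "band_height (res G e)"
  obtain q where q: "q \<in> tube" "\<sigma> * side_height q > 0" "p = thicken q"
    using p(1) by (cases rule: side_cases) (use p(2) in auto)
  let ?t = "Re (fst q)" and ?k = "- \<sigma> * ?b"
  have z: "snd q = 0" using p q by (simp add: thicken_def)
  have k: "?k = 1 \<or> ?k = -1" using \<sigma> band_height_cases[of "res G e"] by auto
  have pos: "?k * Im (fst q) * sin (tilt ?t) > 0"
    using q(2) z by (simp add: side_height_def algebra_simps)
  then have "sin (tilt ?t) \<noteq> 0" by auto
  then have "\<not> ?t \<le> 1/3" "\<not> ?t \<ge> 2/3" using tilt_simps(1,2)[of ?t] by auto
  moreover have "?k * Im (fst q) > 0"
    using pos sin_tilt_nonneg[of ?t] by (metis linorder_not_less mult_nonpos_nonneg)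
  moreover have "\<bar>Im (fst q)\<bar> \<le> 1" using tube_strip_dom[OF q(1)] by (auto simp: strip_dom_iff)
  then have "?k * Im (fst q) \<le> 1" using k by auto
  ultimately show ?thesis
    using half_band_in_region[OF k, of "fst q"] by (simp add: q(3) thicken_def)
qed

lemma core_in_neighbourhood:
  assumes "t \<in> {0..1}"
  shows "(curve G e t, 0) \<in> neighbourhood"
proof -
  consider "t = 0" | "t = 1" | "0 < t" "t < 1" using assms by fastforce
  then show ?thesis
  proof cases
    case 1
    then show ?thesis using disks(1) ends(1) by (simp add: neighbourhood_def tail_def pathstart_def)
  next
    case 2
    then show ?thesis using disks(1) ends(2) by (simp add: neighbourhood_def head_def pathfinish_def)
  next
    case 3
    then have "(Complex t 0, 0) \<in> tube" by (simp add: tube_def)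
    moreover have "thicken (Complex t 0, 0) = (curve G e t, 0)"
      using strip_props(3)[OF edge assms] by (simp add: thicken_def)
    ultimately show ?thesis unfolding neighbourhood_def by (metis UnCI imageI)
  qed
qed

lemma core_in_surface:
  assumes t: "t \<in> {0..1}"
  shows "plane (curve G e t) \<in> surface G"
proof (cases "0 < t \<and> t < 1")
  case True
  then have "(Complex t 0, 0) \<in> tube" "side_height (Complex t 0, 0) = 0"
    by (simp_all add: tube_def side_height_def)
  from zero_side_in_surface[OF this] show ?thesis
    using strip_props(3)[OF edge t] by (simp add: thicken_def plane_def)
next
  case False
  then have "curve G e t \<in> {tail, head}"
    using t by (auto simp: tail_def head_def pathstart_def pathfinish_def)
  then show ?thesis
    using disk_in_surface[OF ends(1)] disk_in_surface[OF ends(2)] subsetD[OF interior_subset disks(1)[OF ends(1)]]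
      subsetD[OF interior_subset disks(1)[OF ends(2)]] unfolding plane_def by auto
qed

end

lemma open_unstereo_preimage:
  assumes "open U"
  shows "open {q. snd q \<noteq> 1 \<and> unstereo q \<in> U}"
proof -
  have "open {q::space4. snd q \<noteq> 1}"
    by (intro open_Collect_neq continuous_intros)
  from continuous_open_preimage[OF continuous_on_unstereo this assms]
  have "open ({q. snd q \<noteq> 1} \<inter> unstereo -` U)" .
  then show ?thesis by (simp add: Int_def vimage_def)
qed

text \<open>
  A form of the tube lemma: near the face \<open>s = 0\<close> of the square, the map stays in any open set that contains the image of that face.
\<close>

lemma shrink_into_open:
  fixes F :: "real \<times> real \<Rightarrow> 'a::topological_space"
  assumes F: "continuous_on ({0..1} \<times> {0..1}) F" and K: "compact K" "K \<subseteq> {0..1}"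
    and U: "open U" "\<And>t. t \<in> K \<Longrightarrow> F (t, 0) \<in> U"
  shows "\<exists>\<delta>>0. \<forall>t\<in>K. \<forall>s\<in>{0..1}. s < \<delta> \<longrightarrow> F (t, s) \<in> U"
proof -
  have "continuous_on ({0..1} \<times> K) (F \<circ> prod.swap)"
    using K by (intro continuous_on_compose continuous_intros continuous_on_subset[OF F] continuous_on_swap) auto
  then obtain W where W: "open W" "W \<inter> ({0..1} \<times> K) = (F \<circ> prod.swap) -` U \<inter> ({0..1} \<times> K)"
    using U(1) unfolding continuous_on_open_invariant by blast
  have "{0} \<times> K \<subseteq> W"
  proof
    fix p assume "p \<in> {0::real} \<times> K"
    then have "p \<in> (F \<circ> prod.swap) -` U \<inter> ({0..1} \<times> K)" using U(2) by auto
    then show "p \<in> W" using W(2) by blast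
  qed
  then obtain X0 where X0: "0 \<in> X0" "open X0" "X0 \<times> K \<subseteq> W"
    using Elementary_Topology.tube_lemma[OF K(1) W(1)] by blast
  then obtain \<delta> where \<delta>: "\<delta> > 0" "ball 0 \<delta> \<subseteq> X0" using open_contains_ball by blast
  have "F (t, s) \<in> U" if "t \<in> K" "s \<in> {0..1}" "s < \<delta>" for t s
  proof -
    have "(s, t) \<in> W \<inter> ({0..1} \<times> K)" using that \<delta> X0 by (auto simp: subset_iff)
    then have "(s, t) \<in> (F \<circ> prod.swap) -` U" unfolding W(2) by blast
    then show ?thesis by simp
  qed
  then show ?thesis using \<delta>(1) by blast
qed

context ribbon_edge
begin

lemma spine_subset_surface: "spine G \<subseteq> surface G"
proof
  fix q assume "q \<in> spine G"
  then obtain z where z: "z \<in> graph_set G" "q = plane z" by (auto simp: spine_def)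
  then consider "z \<in> verts G" | d where "d \<in> edges G" "z \<in> path_image (curve G d)"
    unfolding graph_set_def by blast
  then show "q \<in> surface G"
  proof cases
    case 1
    then show ?thesis using disk_in_surface[OF 1] subsetD[OF interior_subset disks(1)[OF 1]] z by (simp add: plane_def)
  next
    case 2
    interpret d: ribbon_edge G d using ribbon 2 by unfold_locales
    show ?thesis using d.core_in_surface 2 z by (auto simp: path_image_def)
  qed
qed

text \<open>
  The sign \<open>\<sigma>\<close> is \<open>1\<close> if the tail is a plus vertex.  With \<open>band_height\<close> equal to \<open>-1\<close> for A and \<open>1\<close>
  for B, the region is the left one for \<open>\<sigma> = 1\<close> and A, and it changes to the other side when either
  the sign or the label changes.
\<close>

lemma push_off_edge:
  assumes N: "regular_nbhd G N"
  obtains \<sigma> :: real and q where "\<sigma> = 1 \<or> \<sigma> = -1"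
    and "\<sigma> = 1 \<Longrightarrow> push_off N (plane tail) \<in> above \<and> push_off N (plane head) \<in> below"
    and "\<sigma> = -1 \<Longrightarrow> push_off N (plane tail) \<in> below \<and> push_off N (plane head) \<in> above"
    and "path_between (crossing_space (side_region (- \<sigma> * band_height (res G e))))
           (push_off N (plane tail)) (push_off N (plane head)) q"
    and "homotopic_paths (S3 - spine G) (push_off N \<circ> (plane \<circ> curve G e)) q"
proof -
  let ?R = "\<lambda>\<sigma>. side_region (- \<sigma> * band_height (res G e))"
  define F where "F = (\<lambda>(t, s). N (plane (curve G e t), s))"
  have Nc: "continuous_on (surface G \<times> {-1..1}) N" and Ni: "inj_on N (surface G \<times> {-1..1})"
    and NS: "N ` (surface G \<times> {-1..1}) \<subseteq> S3" and N0: "\<And>q. q \<in> surface G \<Longrightarrow> N (q, 0) = q"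
    and Nv: "\<And>v s. v \<in> verts G \<Longrightarrow> s \<in> {-1..1} \<Longrightarrow> s \<noteq> 0 \<Longrightarrow> N (plane v, s) \<in> above \<union> below"
    using N by (auto simp: regular_nbhd_def)
  have cc: "continuous_on {0..1} (curve G e)" using arc_imp_path[OF ends(3)] by (simp add: path_def)
  have Fc: "continuous_on ({0..1} \<times> {0..1}) F"
    unfolding F_def case_prod_beta plane_def
    by (intro continuous_on_compose2[OF Nc] continuous_intros continuous_on_compose2[OF cc])
      (auto simp: core_in_surface simp flip: plane_def)
  have Fsurf: "F (t, s) \<in> S3 - surface G" if "t \<in> {0..1}" "s \<in> {0<..1}" for t s
  proof -
    have in1: "(plane (curve G e t), s) \<in> surface G \<times> {-1..1}" using that core_in_surface by auto
    then have "F (t, s) \<in> S3" using NS by (auto simp: F_def)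
    moreover have "F (t, s) \<notin> surface G"
    proof
      assume a: "F (t, s) \<in> surface G"
      then have "N (plane (curve G e t), s) = N (F (t, s), 0)" using N0[OF a] by (simp add: F_def)
      then have "(plane (curve G e t), s) = (F (t, s), 0)"
        by (rule inj_onD[OF Ni _ in1]) (use a in simp)
      then show False using that by simp
    qed
    ultimately show ?thesis by blast
  qed
  have Fspine: "F (t, s) \<in> S3 - spine G" if "t \<in> {0..1}" "s \<in> {0<..1}" for t s
    using Fsurf[OF that] spine_subset_surface by blast
  have F0: "F (t, 0) = stereo (curve G e t, 0)" if "t \<in> {0..1}" for t
    using N0[OF core_in_surface[OF that]] by (simp add: F_def plane_def)
  define pre where "pre U = {q. snd q \<noteq> 1 \<and> unstereo q \<in> U}" for U
  have pre: "stereo p \<in> pre U \<longleftrightarrow> p \<in> U" for p U by (simp add: pre_def snd_stereo_neq_1)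
  have ends01: "curve G e 0 = tail" "curve G e 1 = head" by (auto simp: tail_def head_def pathstart_def pathfinish_def)
  have pre_open: "open (pre U)" if "open U" for U
    unfolding pre_def using that by (rule open_unstereo_preimage)
  have near: "\<exists>\<delta>>0. \<forall>t\<in>K. \<forall>s\<in>{0..1}. s < \<delta> \<longrightarrow> F (t, s) \<in> pre U"
    if "compact K" "K \<subseteq> {0..1}" "open U" "\<And>t. t \<in> K \<Longrightarrow> (curve G e t, 0) \<in> U" for K U
  proof (rule shrink_into_open[OF Fc that(1,2) pre_open[OF that(3)]])
    fix t assume "t \<in> K"
    then show "F (t, 0) \<in> pre U" using that(2,4) F0[of t] pre by auto
  qed
  obtain d1 where d1: "d1 > 0" "\<forall>t\<in>{0..1}. \<forall>s\<in>{0..1}. s < d1 \<longrightarrow> F (t, s) \<in> pre neighbourhood"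
    using near[OF compact_Icc order_refl open_neighbourhood core_in_neighbourhood] by blast
  obtain d2 where d2: "d2 > 0" "\<forall>t\<in>{0}. \<forall>s\<in>{0..1}. s < d2 \<longrightarrow> F (t, s) \<in> pre (interior (disk G tail) \<times> UNIV)"
    using near[of "{0}" "interior (disk G tail) \<times> UNIV"] disks(1)[OF ends(1)] ends01 by (auto simp: open_Times)
  obtain d3 where d3: "d3 > 0" "\<forall>t\<in>{1}. \<forall>s\<in>{0..1}. s < d3 \<longrightarrow> F (t, s) \<in> pre (interior (disk G head) \<times> UNIV)"
    using near[of "{1}" "interior (disk G head) \<times> UNIV"] disks(1)[OF ends(2)] ends01 by (auto simp: open_Times)
  define \<epsilon> where "\<epsilon> = min 1 (min d1 (min d2 d3)) / 2"
  have \<epsilon>: "0 < \<epsilon>" "\<epsilon> < 1" "\<epsilon> < d1" "\<epsilon> < d2" "\<epsilon> < d3"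
    using d1(1) d2(1) d3(1) by (auto simp: \<epsilon>_def)
  define c where "c t = unstereo (F (t, \<epsilon>))" for t
  have cF: "stereo (c t) = F (t, \<epsilon>)" "c t \<in> neighbourhood" if "t \<in> {0..1}" for t
  proof -
    have "F (t, \<epsilon>) \<in> pre neighbourhood" using d1(2) that \<epsilon> by auto
    then show "stereo (c t) = F (t, \<epsilon>)" "c t \<in> neighbourhood"
      using stereo_unstereo Fsurf[OF that, of \<epsilon>] \<epsilon> by (auto simp: pre_def c_def)
  qed
  have "fst (c 0) \<in> interior (disk G tail)" "fst (c 1) \<in> interior (disk G head)"
    using d2(2) d3(2) \<epsilon> by (auto simp: pre_def c_def mem_Times_iff)
  then have c0: "fst (c 0) \<in> disk G tail" and c1: "fst (c 1) \<in> disk G head"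
    using interior_subset by blast+
  have cs: "c t \<in> side 1 \<union> side (-1)" if "t \<in> {0..1}" for t
    using neighbourhood_minus_surface cF[OF that] Fsurf[OF that, of \<epsilon>] \<epsilon> by auto
  have Fe: "continuous_on {0..1} (\<lambda>t. F (t, \<epsilon>))"
    using \<epsilon> by (intro continuous_on_compose2[OF Fc] continuous_intros) auto
  have "continuous_on {0..1} c"
    unfolding c_def using d1(2) \<epsilon>
    by (intro continuous_on_compose2[OF continuous_on_unstereo Fe]) (auto simp: pre_def)
  then have conn: "connected (c ` {0..1})" by (intro connected_continuous_image) auto
  have "\<exists>\<sigma>. (\<sigma> = 1 \<or> \<sigma> = -1) \<and> c ` {0..1} \<subseteq> side \<sigma>"
  proof -
    have "side 1 \<inter> c ` {0..1} = {} \<or> side (-1) \<inter> c ` {0..1} = {}"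
      using connectedD[OF conn open_side open_side, of 1 "-1"] sides_disjoint cs by blast
    then have "c ` {0..1} \<subseteq> side 1 \<or> c ` {0..1} \<subseteq> side (-1)" using cs by blast
    then show ?thesis by blast
  qed
  then obtain \<sigma> :: real where \<sigma>: "\<sigma> = 1 \<or> \<sigma> = -1" and cside: "\<And>t. t \<in> {0..1} \<Longrightarrow> c t \<in> side \<sigma>" by blast
  \<comment> \<open>the low push-off crosses the plane only in the region, the fibres over the ends not at all\<close>
  have low: "F (t, \<epsilon>) \<in> crossing_space (?R \<sigma>)" if "t \<in> {0..1}" for t
    using side_crosses_in_region[OF cside[OF that] _ \<sigma>] cF(1)[OF that]
    unfolding crossing_space_def by (metis (mono_tags, lifting) imageI mem_Collect_eq)
  have fibre: "F (t, s) \<in> above \<union> below" if "t = 0 \<or> t = 1" "s \<in> {0<..1}" for t s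
    using that Nv[OF ends(1), of s] Nv[OF ends(2), of s] ends01 by (auto simp: F_def)
  have stay: "(F (t, \<epsilon>) \<in> above \<longrightarrow> F (t, 1) \<in> above) \<and> (F (t, \<epsilon>) \<in> below \<longrightarrow> F (t, 1) \<in> below)"
    if t: "t = 0 \<or> t = 1" for t
  proof -
    let ?h = "\<lambda>s. snd (fst (F (t, s)))"
    have "continuous_on {\<epsilon>..1} (\<lambda>s. F (t, s))"
      using \<epsilon> t by (intro continuous_on_compose2[OF Fc] continuous_intros) auto
    then have "continuous_on {\<epsilon>..1} ?h" by (intro continuous_intros)
    then have conn: "connected (?h ` {\<epsilon>..1})" by (intro connected_continuous_image) auto
    have nz: "?h s \<noteq> 0" if "s \<in> {\<epsilon>..1}" for s
      using fibre[OF t, of s] that \<epsilon> by (auto simp: above_def below_def)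
    have hin: "?h \<epsilon> \<in> ?h ` {\<epsilon>..1}" "?h 1 \<in> ?h ` {\<epsilon>..1}" using \<epsilon> by auto
    have "0 \<notin> ?h ` {\<epsilon>..1}"
    proof
      assume "0 \<in> ?h ` {\<epsilon>..1}"
      then show False using nz by (elim imageE) metis
    qed
    then have "\<not> (?h \<epsilon> \<le> 0 \<and> 0 \<le> ?h 1)" "\<not> (?h 1 \<le> 0 \<and> 0 \<le> ?h \<epsilon>)"
      using connectedD_interval[OF conn hin, of 0] connectedD_interval[OF conn hin(2,1), of 0] by argo+
    then have "(?h \<epsilon> > 0 \<longrightarrow> ?h 1 > 0) \<and> (?h \<epsilon> < 0 \<longrightarrow> ?h 1 < 0)" by linarith
    moreover have "F (t, 1) \<in> S3" using Fsurf[of t 1] t by auto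
    ultimately show ?thesis by (auto simp: above_def below_def)
  qed
  have push: "push_off N (plane tail) = F (0, 1)" "push_off N (plane head) = F (1, 1)"
    by (simp_all add: push_off_def F_def ends01)
  have tail_side: "\<sigma> * snd (c 0) > 0" and head_side: "\<sigma> * snd (c 1) < 0"
    using side_over_tail[OF cside c0] side_over_head[OF cside c1] by auto
  \<comment> \<open>the top edge of the rectangle is deformed into the other three edges\<close>
  let ?K = "{0..1} \<times> {\<epsilon>..1} :: (real \<times> real) set"
  let ?b = "linepath (0, \<epsilon>) (1, \<epsilon>) :: real \<Rightarrow> real \<times> real"
  let ?l = "linepath (0, 1) (0, \<epsilon>) :: real \<Rightarrow> real \<times> real"
  let ?r = "linepath (1, \<epsilon>) (1, 1) :: real \<Rightarrow> real \<times> real"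
  let ?p = "linepath (0, 1) (1, 1) :: real \<Rightarrow> real \<times> real"
  have K: "convex ?K" by (intro convex_Times convex_real_interval)
  have line: "path_between ?K x y (linepath x y)" if "x \<in> ?K" "y \<in> ?K" for x y
    using closed_segment_subset[OF that K] by (simp add: path_between_def)
  have lines: "path_between ?K (0, 1) (0, \<epsilon>) ?l" "path_between ?K (0, \<epsilon>) (1, \<epsilon>) ?b"
    "path_between ?K (1, \<epsilon>) (1, 1) ?r" "path_between ?K (0, 1) (1, 1) ?p"
    using \<epsilon> by (auto intro!: line)
  then have round: "path_between ?K (0, 1) (1, 1) (?l +++ (?b +++ ?r))" by blast
  have FK: "continuous_on ?K F" using \<epsilon> by (intro continuous_on_subset[OF Fc]) auto
  have "homotopic_paths (S3 - spine G) (F \<circ> ?p) (F \<circ> (?l +++ (?b +++ ?r)))"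
    using Fspine \<epsilon> by (intro homotopic_paths_convex_image[OF K FK _ lines(4) round]) auto
  moreover have "F \<circ> ?p = push_off N \<circ> (plane \<circ> curve G e)"
    by (rule ext) (simp add: linepath_def F_def push_off_def algebra_simps)
  moreover have "path_between (crossing_space (?R \<sigma>)) (push_off N (plane tail)) (push_off N (plane head))
      (F \<circ> (?l +++ (?b +++ ?r)))"
  proof -
    let ?T = "{p \<in> ?K. fst p = 0 \<or> fst p = 1 \<or> snd p = \<epsilon>}"
    have "path_between ?T (0, 1) (1, 1) (?l +++ (?b +++ ?r))"
    proof (intro path_between_join)
      have l: "fst q = 0" if "q \<in> closed_segment (0, 1) (0, \<epsilon>)" for q :: "real \<times> real"
        using that by (auto simp: in_segment)
      have r: "fst q = 1" if "q \<in> closed_segment (1, \<epsilon>) (1, 1)" for q :: "real \<times> real"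
        using that by (auto simp: in_segment)
      have b: "snd q = \<epsilon>" if "q \<in> closed_segment (0, \<epsilon>) (1, \<epsilon>)" for q :: "real \<times> real"
        using that by (auto simp: in_segment algebra_simps)
      show "path_between ?T (0, 1) (0, \<epsilon>) ?l" "path_between ?T (0, \<epsilon>) (1, \<epsilon>) ?b" "path_between ?T (1, \<epsilon>) (1, 1) ?r"
        using lines l r b unfolding path_between_def by (simp_all add: subset_iff)
    qed
    moreover have "F ` ?T \<subseteq> crossing_space (?R \<sigma>)"
    proof (rule image_subsetI)
      fix p assume p: "p \<in> ?T"
      obtain t s where p_eq: "p = (t, s)" by (cases p)
      have ts: "(t, s) \<in> ?K" "t = 0 \<or> t = 1 \<or> s = \<epsilon>" using p unfolding p_eq by auto
      show "F p \<in> crossing_space (?R \<sigma>)"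
      proof (cases "s = \<epsilon>")
        case True
        then show ?thesis using low ts by (auto simp: p_eq)
      next
        case False
        then have "F (t, s) \<in> above \<union> below" using ts \<epsilon> by (intro fibre) auto
        then show ?thesis
          using above_subset_crossing below_subset_crossing unfolding p_eq by blast
      qed
    qed
    ultimately show ?thesis
      unfolding push using continuous_on_subset[OF FK] by (intro path_between_image[where X = ?T]) auto
  qed
  moreover have "\<sigma> = 1 \<Longrightarrow> F (0, 1) \<in> above \<and> F (1, 1) \<in> below" "\<sigma> = -1 \<Longrightarrow> F (0, 1) \<in> below \<and> F (1, 1) \<in> above"
    using tail_side head_side stay[of 0] stay[of 1] cF(1)[of 0, symmetric] cF(1)[of 1, symmetric]
    by (auto simp: above_eq below_eq)
  ultimately show ?thesis using \<sigma> that push by metis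
qed

end

section \<open>The image of a walk\<close>

lemma word_value_Nil: "word_value G y [] = \<one>\<^bsub>pi1 (S3 - spine G) y\<^esub>"
  by (simp add: word_value_def)

lemma compact_graph_set:
  assumes "plane_graph G"
  shows "compact (graph_set G)"
  using assms unfolding graph_set_def plane_graph_def
  by (intro compact_Un compact_UN) (auto intro: finite_imp_compact compact_path_image arc_imp_path)

locale pushed_surface =
  fixes G :: "'e state_surface" and N :: "space4 \<times> real \<Rightarrow> space4" and y :: space4
  assumes ribbon: "state_ribbon G" and nbhd: "regular_nbhd G N" and y_above: "y \<in> above"
begin

abbreviation "X \<equiv> S3 - spine G"
abbreviation "\<Omega> \<equiv> crossing_space (outside (graph_set G))"

sublocale drawn_graph G
  using ribbon by unfold_locales (simp add: state_ribbon_def)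

lemma compact_graph: "compact (graph_set G)"
  by (rule compact_graph_set[OF pg])

lemma region_outside: "region_of (graph_set G) (outside (graph_set G))"
  by (rule region_of_outside[OF compact_graph])

lemma outside_subset: "\<Omega> \<subseteq> X"
  by (rule crossing_space_subset[OF region_outside])

lemmas outside_path = path_between_mono[OF _ outside_subset]

lemma spine_in_surface: "spine G \<subseteq> surface G"
proof
  fix q assume q: "q \<in> spine G"
  show "q \<in> surface G"
  proof (cases "edges G = {}")
    case True
    then obtain v where v: "v \<in> verts G" "q = stereo (v, 0)" using q by (auto simp: spine_eq graph_set_def)
    then have "v \<in> disk G v" using ribbon interior_subset[of "disk G v"] by (auto simp: state_ribbon_def)
    then show ?thesis using v unfolding surface_def by blast
  next
    case False
    then obtain e where "e \<in> edges G" by blast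
    then interpret ribbon_edge G e using ribbon by unfold_locales
    show ?thesis using q spine_subset_surface by blast
  qed
qed

lemma push_off_continuous: "continuous_on (surface G) (push_off N)"
proof -
  have "continuous_on (surface G \<times> {-1..1}) N" using nbhd by (simp add: regular_nbhd_def)
  then show ?thesis
    unfolding push_off_def by (rule continuous_on_compose2) (auto intro!: continuous_intros)
qed

lemma push_off_image: "push_off N ` surface G \<subseteq> S3 - surface G"
proof (rule image_subsetI)
  fix q assume q: "q \<in> surface G"
  have N: "inj_on N (surface G \<times> {-1..1})" "N ` (surface G \<times> {-1..1}) \<subseteq> S3"
    "\<And>q. q \<in> surface G \<Longrightarrow> N (q, 0) = q" using nbhd by (auto simp: regular_nbhd_def)
  have "push_off N q \<notin> surface G"
  proof
    assume a: "push_off N q \<in> surface G"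
    then have "N (q, 1) = N (push_off N q, 0)" using N(3)[OF a] by (simp add: push_off_def)
    then have "(q, 1::real) = (push_off N q, 0)" by (rule inj_onD[OF N(1)]) (use a q in auto)
    then show False by simp
  qed
  moreover have "push_off N q \<in> S3" using N(2) q by (auto simp: push_off_def)
  ultimately show "push_off N q \<in> S3 - surface G" by blast
qed

lemma push_off_between:
  assumes "path_between (spine G) a b p"
  shows "path_between X (push_off N a) (push_off N b) (push_off N \<circ> p)"
  using spine_in_surface push_off_image
  by (intro path_between_image[OF assms] continuous_on_subset[OF push_off_continuous]) auto

lemma plane_image: "path_between \<Gamma> a b p \<Longrightarrow> path_between (spine G) (plane a) (plane b) (plane \<circ> p)"
  by (rule path_between_image) (auto simp: spine_def continuous_plane)

lemma plane_edge_between: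
  "e \<in> edges G \<Longrightarrow> path_between (spine G) (plane (pathstart (dcurve G (e, d))))
    (plane (pathfinish (dcurve G (e, d)))) (plane \<circ> dcurve G (e, d))"
  by (rule plane_image[OF edge_between]) simp

lemma walk_path_between:
  "edge_walk G v w v' \<Longrightarrow> path_between (spine G) (plane v) (plane v') (walk_path G v' w)"
  using plane_image[OF walk_curve_between] by (simp only: plane_walk_curve)

text \<open>
  The label of an edge refers to its direction from plus to minus, which may differ both from the
  direction of its arc and from that of the step.  In each of the four cases the step or its
  reverse is a descent.
\<close>

lemma step_push_off:
  assumes e: "e \<in> edges G"
    and s: "path_between \<Omega> y (push_off N (plane (pathstart (dcurve G (e, d))))) s"
    and t: "path_between \<Omega> y (push_off N (plane (pathfinish (dcurve G (e, d))))) t"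
  obtains L where "path_between X y y L"
    and "homotopic_paths X (s +++ (push_off N \<circ> (plane \<circ> dcurve G (e, d)))) (L +++ t)"
    and "\<And>ls. word_value G y ls \<in> carrier (pi1 X y) \<Longrightarrow>
      word_value G y (step_letters G N (e, d) @ ls) = path_class X L \<otimes>\<^bsub>pi1 X y\<^esub> word_value G y ls"
proof -
  note [trans] = homotopic_paths_trans
  note goal = that
  interpret ribbon_edge G e using ribbon e by unfold_locales
  obtain \<sigma> :: real and q where \<sigma>: "\<sigma> = 1 \<or> \<sigma> = -1"
    and up: "\<sigma> = 1 \<Longrightarrow> push_off N (plane tail) \<in> above \<and> push_off N (plane head) \<in> below"
    and down: "\<sigma> = -1 \<Longrightarrow> push_off N (plane tail) \<in> below \<and> push_off N (plane head) \<in> above"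
    and q: "path_between (crossing_space (side_region (- \<sigma> * band_height (res G e))))
           (push_off N (plane tail)) (push_off N (plane head)) q"
    and hom: "homotopic_paths X (push_off N \<circ> (plane \<circ> curve G e)) q"
    using push_off_edge[OF nbhd] by blast
  let ?k = "- \<sigma> * band_height (res G e)"
  define R where "R = side_region ?k"
  define P where "P = push_off N \<circ> (plane \<circ> curve G e)"
  let ?a = "strip G e (Complex (1/2) (?k / 2))"
  have a: "?a \<notin> graph_set G"
    using \<sigma> band_height_cases[of "res G e"] by (intro half_band_avoids_graph) auto
  have R: "R = connected_component_set (- graph_set G) ?a" by (simp add: R_def side_region_def)
  have pos: "positive_vertex N tail \<longleftrightarrow> \<sigma> = 1" "positive_vertex N head \<longleftrightarrow> \<sigma> = -1"
    using \<sigma> up down above_below_disjoint by (auto simp: positive_vertex_def)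
  have left: "left_region G (e, b) = side_region (if b then 1 else -1)" for b
    by (simp add: left_region_def side_region_def)
  have lab: "edge_label G N e = (if bounded R then Some R else None)"
    using \<sigma> pos(1) by (auto simp: edge_label_def Let_def left right_region_def R_def tail_def[symmetric]
        band_height_def split: resolution.split)
  have letters: "step_letters G N (e, d) =
      (if bounded R then [(R, positive_vertex N (pathstart (dcurve G (e, d))))] else [])"
    by (simp add: step_letters_def lab)
  have dT: "dcurve G (e, True) = curve G e" and dF: "dcurve G (e, False) = reversepath (curve G e)"
    by (simp_all add: dcurve_def)
  have PF: "push_off N \<circ> (plane \<circ> reversepath (curve G e)) = reversepath P"
    by (simp add: P_def path_compose_reversepath)
  have P: "path_between X (push_off N (plane tail)) (push_off N (plane head)) P"
    using push_off_between[OF plane_edge_between[OF e, of True]] by (simp add: P_def dT tail_def head_def)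
  have qR: "path_between (crossing_space R) (push_off N (plane tail)) (push_off N (plane head)) q"
    using q by (simp add: R_def)
  \<comment> \<open>\<open>Q\<close> is the push-off of the edge in the direction from plus to minus, and \<open>q'\<close> its deformation into the crossing space\<close>
  have descending: thesis
    if Q: "path_between X u v Q" "homotopic_paths X Q q'" "path_between (crossing_space R) u v q'"
      and uv: "u \<in> above" "v \<in> below"
      and dir: "s = s' \<and> t = t' \<and> push_off N \<circ> (plane \<circ> dcurve G (e, d)) = Q \<and>
          positive_vertex N (pathstart (dcurve G (e, d))) \<or>
        s = t' \<and> t = s' \<and> push_off N \<circ> (plane \<circ> dcurve G (e, d)) = reversepath Q \<and>
          \<not> positive_vertex N (pathstart (dcurve G (e, d)))"
      and st: "path_between \<Omega> y u s'" "path_between \<Omega> y v t'"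
    for u v Q q' s' t'
  proof -
    obtain L where L: "path_between X y y L" "homotopic_paths X (s' +++ q') (L +++ t')"
      and wT: "\<And>ls. word_value G y ls \<in> carrier (pi1 X y) \<Longrightarrow>
        word_value G y ((if bounded R then [(R, True)] else []) @ ls) = path_class X L \<otimes>\<^bsub>pi1 X y\<^esub> word_value G y ls"
      and wF: "\<And>ls. word_value G y ls \<in> carrier (pi1 X y) \<Longrightarrow>
        word_value G y ((if bounded R then [(R, False)] else []) @ ls) = path_class X (reversepath L) \<otimes>\<^bsub>pi1 X y\<^esub> word_value G y ls"
      using descending_step[OF compact_graph R a y_above uv st Q(3)] by blast
    have stX: "path_between X y u s'" "path_between X y v t'"
      by (rule outside_path[OF st(1)], rule outside_path[OF st(2)])
    have "homotopic_paths X (s' +++ Q) (s' +++ q')"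
      by (rule homotopic_join_right[OF Q(2) stX(1) Q(1)])
    also have "homotopic_paths X \<dots> (L +++ t')" by (rule L(2))
    finally have hQ: "homotopic_paths X (s' +++ Q) (L +++ t')" .
    from dir show thesis
    proof
      assume dir: "s = s' \<and> t = t' \<and> push_off N \<circ> (plane \<circ> dcurve G (e, d)) = Q \<and>
          positive_vertex N (pathstart (dcurve G (e, d)))"
      then have "step_letters G N (e, d) = (if bounded R then [(R, True)] else [])" using letters by simp
      then show thesis using L(1) hQ wT dir by (intro goal[of L]) (simp_all only:)
    next
      assume dir: "s = t' \<and> t = s' \<and> push_off N \<circ> (plane \<circ> dcurve G (e, d)) = reversepath Q \<and>
          \<not> positive_vertex N (pathstart (dcurve G (e, d)))"
      then have "step_letters G N (e, d) = (if bounded R then [(R, False)] else [])" using letters by simp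
      then show thesis
        using homotopic_transpose[OF stX Q(1) L(1) hQ] path_between_reverse[OF L(1)] wF dir
        by (intro goal[of "reversepath L"]) (simp_all only:)
    qed
  qed
  have ne: "tail = pathstart (curve G e)" "head = pathfinish (curve G e)" by (simp_all add: tail_def head_def)
  from \<sigma> show thesis
  proof
    assume \<sigma>1: "\<sigma> = 1"
    show thesis
    proof (cases d)
      case True
      show thesis
        by (rule descending[OF P hom[folded P_def] qR, of s t])
          (use up[OF \<sigma>1] s t pos \<sigma>1 True in \<open>auto simp: dT P_def ne\<close>)
    next
      case False
      show thesis
        by (rule descending[OF P hom[folded P_def] qR, of t s])
          (use up[OF \<sigma>1] s t pos \<sigma>1 False in \<open>auto simp: dF PF ne\<close>)
    qed
  next
    assume \<sigma>1: "\<sigma> = -1"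
    note rP = path_between_reverse[OF P] homotopic_paths_reversepath_D[OF hom[folded P_def]] path_between_reverse[OF qR]
    show thesis
    proof (cases d)
      case True
      show thesis
        by (rule descending[OF rP, of t s])
          (use down[OF \<sigma>1] s t pos \<sigma>1 True in \<open>auto simp: dT P_def ne\<close>)
    next
      case False
      show thesis
        by (rule descending[OF rP, of s t])
          (use down[OF \<sigma>1] s t pos \<sigma>1 False in \<open>auto simp: dF PF ne\<close>)
    qed
  qed
qed

lemma vertex_side: "v \<in> verts G \<Longrightarrow> push_off N (plane v) \<in> \<Omega>"
proof -
  assume "v \<in> verts G"
  then have "push_off N (plane v) \<in> above \<union> below"
    using nbhd by (simp add: regular_nbhd_def push_off_def)
  then show ?thesis using above_subset_crossing below_subset_crossing by blast
qed

text \<open>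
  The push-off of a partial walk is not a loop at \<open>y\<close>.  It is closed up through the unbounded
  region; by simple connectedness of the crossing space the choice of \<open>s\<close> and \<open>t\<close> does not matter.
\<close>

lemma walk_push_off:
  assumes "edge_walk G v w v'"
    and "path_between \<Omega> y (push_off N (plane v)) s" and "path_between \<Omega> y (push_off N (plane v')) t"
  shows "\<exists>L. path_between X y y L \<and>
    homotopic_paths X (s +++ (push_off N \<circ> walk_path G v' w)) (L +++ t) \<and>
    word_value G y (concat (map (step_letters G N) w)) = path_class X L"
  using assms(1,2)
proof (induction w arbitrary: v s)
  case Nil
  note [trans] = homotopic_paths_trans
  have v: "v = v'" using Nil by simp
  have sX: "path_between X y (push_off N (plane v)) s" and tX: "path_between X y (push_off N (plane v)) t"
    using outside_path[OF Nil.prems(2)] outside_path[OF assms(3)] v by simp_all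
  have "homotopic_paths X (s +++ (push_off N \<circ> walk_path G v' [])) s"
  proof -
    have "push_off N \<circ> walk_path G v' [] = linepath (push_off N (plane v)) (push_off N (plane v))"
      by (simp add: walk_path_def o_def linepath_refl v)
    then show ?thesis using sX by (simp only:) (intro homotopic_paths_rid', auto simp: path_between_def)
  qed
  also have "homotopic_paths X s t"
    using crossing_space_homotopic[OF region_outside Nil.prems(2)] assms(3) v by simp
  also have "homotopic_paths X t (linepath y y +++ t)"
    using tX by (intro homotopic_paths_sym[OF homotopic_paths_lid']) (auto simp: path_between_def)
  finally have "homotopic_paths X (s +++ (push_off N \<circ> walk_path G v' [])) (linepath y y +++ t)" .
  moreover have "path_between X y y (linepath y y)"
    using path_betweenD(5)[OF sX] by (rule path_between_refl)
  moreover have "word_value G y (concat (map (step_letters G N) [])) = path_class X (linepath y y)"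
    by (simp add: word_value_Nil pi1_one)
  ultimately show ?case by blast
next
  case (Cons a w)
  note [trans] = homotopic_paths_trans
  obtain e d where a: "a = (e, d)" by fastforce
  have e: "e \<in> edges G" and v: "v = pathstart (dcurve G (e, d))"
    and walk: "edge_walk G (pathfinish (dcurve G (e, d))) w v'"
    using Cons.prems(1) a by auto
  let ?m = "push_off N (plane (pathfinish (dcurve G (e, d))))"
  let ?p = "push_off N \<circ> (plane \<circ> dcurve G (e, d))" and ?r = "push_off N \<circ> walk_path G v' w"
  have "y \<in> \<Omega>" using y_above above_subset_crossing by blast
  then obtain r where r: "path_between \<Omega> y ?m r"
    using crossing_space_path[OF region_outside _ vertex_side[OF dcurve_arc(3)[of "(e, d)"]]] e
    unfolding fst_conv by metis
  obtain L where L: "path_between X y y L" "homotopic_paths X (s +++ ?p) (L +++ r)"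
    and wL: "\<And>ls. word_value G y ls \<in> carrier (pi1 X y) \<Longrightarrow>
      word_value G y (step_letters G N (e, d) @ ls) = path_class X L \<otimes>\<^bsub>pi1 X y\<^esub> word_value G y ls"
    using step_push_off[OF e Cons.prems(2)[unfolded v] r] by blast
  obtain M where M: "path_between X y y M" "homotopic_paths X (r +++ ?r) (M +++ t)"
    and wM: "word_value G y (concat (map (step_letters G N) w)) = path_class X M"
    using Cons.IH[OF walk r] by blast
  have sX: "path_between X y (push_off N (plane v)) s" and rX: "path_between X y ?m r"
    and tX: "path_between X y (push_off N (plane v')) t"
    using outside_path[OF Cons.prems(2)] outside_path[OF r] outside_path[OF assms(3)] by simp_all
  have pX: "path_between X (push_off N (plane v)) ?m ?p"
    using push_off_between[OF plane_edge_between[OF e]] v by blast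
  have qX: "path_between X ?m (push_off N (plane v')) ?r"
    by (rule push_off_between[OF walk_path_between[OF walk]])
  have "push_off N \<circ> walk_path G v' (a # w) = ?p +++ ?r"
    by (simp add: walk_path_def a path_compose_join)
  then have "homotopic_paths X (s +++ (push_off N \<circ> walk_path G v' (a # w))) ((s +++ ?p) +++ ?r)"
    using homotopic_paths_sym[OF homotopic_assoc[OF sX pX qX]] by simp
  also have "homotopic_paths X \<dots> ((L +++ r) +++ ?r)"
    by (rule homotopic_join_left[OF L(2) path_between_join[OF sX pX] qX])
  also have "homotopic_paths X \<dots> (L +++ (r +++ ?r))"
    by (rule homotopic_assoc[OF L(1) rX qX])
  also have "homotopic_paths X \<dots> (L +++ (M +++ t))"
    by (rule homotopic_join_right[OF M(2) L(1) path_between_join[OF rX qX]])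
  also have "homotopic_paths X \<dots> ((L +++ M) +++ t)"
    by (rule homotopic_paths_sym[OF homotopic_assoc[OF L(1) M(1) tX]])
  finally have hom: "homotopic_paths X (s +++ (push_off N \<circ> walk_path G v' (a # w))) ((L +++ M) +++ t)" .
  have "word_value G y (concat (map (step_letters G N) (a # w))) =
      path_class X L \<otimes>\<^bsub>pi1 X y\<^esub> path_class X M"
    using wL[of "concat (map (step_letters G N) w)"] pi1_carrierI[OF M(1)] by (simp add: wM a)
  also have "\<dots> = path_class X (L +++ M)"
    using L(1) M(1) by (intro pi1_mult_path_class) (simp_all add: loops_at_eq)
  finally show ?case using hom path_between_join[OF L(1) M(1)] by blast
qed

lemma stallings_map_path_class:
  assumes p: "path_between (spine G) a b p"
  shows "stallings_map G N (path_class (spine G) p) = path_class X (push_off N \<circ> p)"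
proof -
  have id: "(\<lambda>q. q) \<circ> r = r" for r :: "real \<Rightarrow> space4" by (simp add: o_def)
  have "pi1_map (surface G) (\<lambda>q. q) (path_class (spine G) p) = path_class (surface G) p"
    using pi1_map_path_class[OF p continuous_on_id, of "surface G"] spine_in_surface by (simp add: id)
  moreover have ps: "path_between (surface G) a b p" using path_between_mono[OF p spine_in_surface] .
  then have "pi1_map (S3 - surface G) (push_off N) (path_class (surface G) p) = path_class (S3 - surface G) (push_off N \<circ> p)"
    by (rule pi1_map_path_class[OF _ push_off_continuous push_off_image])
  moreover have "path_between (S3 - surface G) (push_off N a) (push_off N b) (push_off N \<circ> p)"
    by (rule path_between_image[OF ps push_off_continuous push_off_image])
  then have "pi1_map X (\<lambda>q. q) (path_class (S3 - surface G) (push_off N \<circ> p)) = path_class X (push_off N \<circ> p)"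
    using pi1_map_path_class[OF _ continuous_on_id, of "S3 - surface G" _ _ "push_off N \<circ> p" X] spine_in_surface
    by (simp add: id Diff_mono)
  ultimately show ?thesis by (simp add: stallings_map_def)
qed

text \<open>
  The plane is embedded homeomorphically, so loops in the spine are images of loops in the plane graph.
\<close>

lemma pi1_spine_walks:
  assumes x: "x \<in> verts G" and \<gamma>: "\<gamma> \<in> carrier (pi1 (spine G) (plane x))"
  shows "\<exists>w. edge_walk G x w x \<and> \<gamma> = path_class (spine G) (walk_path G x w)"
proof -
  obtain p where p: "path_between (spine G) (plane x) (plane x) p" "\<gamma> = path_class (spine G) p"
    using \<gamma> by (auto simp: pi1_def loops_at_eq)
  define q where "q = (fst \<circ> unstereo) \<circ> p"
  have flat: "(fst \<circ> unstereo) (plane z) = z" for z by (simp add: plane_def)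
  have "spine G \<subseteq> {q. snd q \<noteq> 1}" using snd_stereo_neq_1 by (auto simp: spine_eq)
  then have "continuous_on (spine G) (fst \<circ> unstereo)"
    by (intro continuous_on_compose continuous_on_subset[OF continuous_on_unstereo] continuous_intros)
  moreover have "(fst \<circ> unstereo) ` spine G \<subseteq> \<Gamma>" by (auto simp: spine_eq)
  ultimately have q: "path_between \<Gamma> x x q"
    using path_between_image[OF p(1)] flat unfolding q_def by metis
  obtain w where w: "edge_walk G x w x" "homotopic_paths \<Gamma> q (walk_curve x w)"
    using loop_homotopic_walk[OF q x] by blast
  have "homotopic_paths (spine G) p (plane \<circ> q)"
  proof (rule homotopic_paths_eq)
    fix t :: real assume "t \<in> {0..1}"
    then have "p t \<in> spine G" using p(1) by (auto simp: path_between_def path_image_def)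
    then show "p t = (plane \<circ> q) t" by (auto simp: spine_eq q_def plane_def)
  qed (use p(1) in \<open>auto simp: path_between_def\<close>)
  moreover have "homotopic_paths (spine G) (plane \<circ> q) (walk_path G x w)"
    using homotopic_paths_continuous_image[OF w(2) continuous_plane]
    by (simp add: plane_walk_curve spine_def)
  ultimately show ?thesis using w(1) p(2) path_class_eqI homotopic_paths_trans by metis
qed

lemma stallings_word:
  assumes y: "y = push_off N (plane x)" and walk: "edge_walk G x w x"
  shows "stallings_map G N (path_class (spine G) (walk_path G x w)) =
    word_value G y (concat (map (step_letters G N) w))"
proof -
  note [trans] = homotopic_paths_trans
  have y\<Omega>: "y \<in> \<Omega>" using y_above above_subset_crossing by blast
  let ?c = "linepath y y" and ?p = "push_off N \<circ> walk_path G x w"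
  have c\<Omega>: "path_between \<Omega> y y ?c" using y\<Omega> by (rule path_between_refl)
  obtain L where L: "path_between X y y L" "homotopic_paths X (?c +++ ?p) (L +++ ?c)"
    "word_value G y (concat (map (step_letters G N) w)) = path_class X L"
    using walk_push_off[OF walk, of ?c ?c] c\<Omega> y by auto
  have p: "path_between X y y ?p" using push_off_between[OF walk_path_between[OF walk]] y by simp
  have "homotopic_paths X ?p (?c +++ ?p)"
    using p by (intro homotopic_paths_sym[OF homotopic_paths_lid']) (auto simp: path_between_def)
  also have "homotopic_paths X \<dots> (L +++ ?c)" by (rule L(2))
  also have "homotopic_paths X \<dots> L"
    using L(1) by (intro homotopic_paths_rid') (auto simp: path_between_def)
  finally have "path_class X ?p = path_class X L" by (rule path_class_eqI)
  then show ?thesis using stallings_map_path_class[OF walk_path_between[OF walk]] L(3) by simp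
qed

end

theorem proposition4p5:
  fixes G :: "'e state_surface"
    and N :: "space4 \<times> real \<Rightarrow> space4"
    and x :: complex
  assumes "state_ribbon G"
    and "connected (graph_set G)"
    and "\<not> (\<exists>v. cut_vertex G v)"
    and "regular_nbhd G N"
    and "x \<in> verts G"
    and "positive_vertex N x"
  shows "(\<forall>\<gamma>\<in>carrier (pi1 (spine G) (plane x)).
            \<exists>w. edge_walk G x w x \<and> \<gamma> = path_class (spine G) (walk_path G x w)) \<and>
         (\<forall>w. edge_walk G x w x \<longrightarrow>
            stallings_map G N (path_class (spine G) (walk_path G x w)) =
            word_value G (push_off N (plane x)) (concat (map (step_letters G N) w)))"
proof -
  interpret pushed_surface G N "push_off N (plane x)"
    using assms(1,4,6) by unfold_locales (simp_all add: positive_vertex_def)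
  show ?thesis
    using pi1_spine_walks[OF assms(5)] stallings_word[OF refl] by blast
qed

end
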